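(* Let $0<p<2$, $q>0$, $M>0$ and $\alpha\le\frac{1}{2p}$ with $\alpha>0$ and $s=\alpha+\frac12-\frac1p>0$. In the Gaussian sequence model $Y_i=\theta_i+n^{-1/2}z_i$ ($z_i$ i.i.d. $N(0,1)$), let $m_3=n^{p/(1+2ps)}$, let $\tau_i=2\lceil\log_2(i/m_3)\rceil$ for $i>m_3$, let $\mu_{n,i}=E_0\{(Y_i^2-\tau_i/n)_+\}$ (expectation under $\theta=0$), let $J_*$ be the largest integer with $2^{J_*}m_3\le n^{1/(4s)}\log n$, and define $$\hat Q_3=\sum_{i=1}^{m_3}\Big(Y_i^2-\frac1n\Big)+\sum_{i=m_3+1}^{2^{J_*}m_3}\Big\{\Big(Y_i^2-\frac{\tau_i}{n}\Big)_+-\mu_{n,i}\Big\}.$$ Then there is a constant $C>0$ such that, for $\Theta=B^\alpha_{p,q}(M)$ and for $\Theta=L_p(\alpha,M)$, $$\sup_{\theta\in\Theta}E_\theta(\hat Q_3-Q(\theta))^2\le C\,n^{-(2-p/(1+2ps))}(1+o(1))\quad(n\to\infty),$$ where $Q(\theta)=\sum_i\theta_i^2$.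
   Context: $\lceil x\rceil$ is the smallest integer $\ge x$; $m_3$ is treated as an integer. The $L_p$ ball is $L_p(\alpha,M)=\{\theta:(\sum_{i\ge1}i^{ps}|\theta_i|^p)^{1/p}\le M\}$ with $s=\alpha+\frac12-\frac1p$. For Besov balls, sequences are doubly indexed $\theta_{j,k}$, $j=0,1,\dots$, $k=0,\dots,2^j-1$, identified with $\theta_i$ via $i=2^j+k$, and $B^\alpha_{p,q}(M)=\{\theta:(\sum_{j\ge0}(2^{js}(\sum_{k=0}^{2^j-1}|\theta_{j,k}|^p)^{1/p})^q)^{1/q}\le M\}$. *)

theory Defs
  imports "HOL-Probability.Probability"
begin

text \<open>Sequences are functions nat => real; only indices i >= 1 are used (theta 0 is ignored).\<close>

definition smooth_index :: "real \<Rightarrow> real \<Rightarrow> real" where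
  "smooth_index \<alpha> p = \<alpha> + 1/2 - 1/p"

definition Lp_ball :: "real \<Rightarrow> real \<Rightarrow> real \<Rightarrow> (nat \<Rightarrow> real) set" where
  "Lp_ball p \<alpha> M = {\<theta>. summable (\<lambda>i. real (Suc i) powr (p * smooth_index \<alpha> p) * \<bar>\<theta> (Suc i)\<bar> powr p)
      \<and> (\<Sum>i. real (Suc i) powr (p * smooth_index \<alpha> p) * \<bar>\<theta> (Suc i)\<bar> powr p) powr (1/p) \<le> M}"

text \<open>Besov ball B^alpha_{p,q}(M), with theta_{j,k} = theta (2^j + k).\<close>
definition besov_level :: "real \<Rightarrow> real \<Rightarrow> (nat \<Rightarrow> real) \<Rightarrow> nat \<Rightarrow> real" where
  "besov_level p s \<theta> j = (2 powr (real j * s) * (\<Sum>k<2^j. \<bar>\<theta> (2^j + k)\<bar> powr p) powr (1/p))"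

definition Besov_ball :: "real \<Rightarrow> real \<Rightarrow> real \<Rightarrow> real \<Rightarrow> (nat \<Rightarrow> real) set" where
  "Besov_ball p q \<alpha> M = {\<theta>. summable (\<lambda>j. besov_level p (smooth_index \<alpha> p) \<theta> j powr q)
      \<and> (\<Sum>j. besov_level p (smooth_index \<alpha> p) \<theta> j powr q) powr (1/q) \<le> M}"

definition Qfun :: "(nat \<Rightarrow> real) \<Rightarrow> real" where
  "Qfun \<theta> = (\<Sum>i. (\<theta> (Suc i))\<^sup>2)"

definition m3 :: "real \<Rightarrow> real \<Rightarrow> nat \<Rightarrow> nat" where
  "m3 p s n = nat \<lfloor>real n powr (p / (1 + 2 * p * s))\<rfloor>"

definition tau :: "real \<Rightarrow> real \<Rightarrow> nat \<Rightarrow> nat \<Rightarrow> real" where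
  "tau p s n i = 2 * of_int \<lceil>log 2 (real i / real (m3 p s n))\<rceil>"

text \<open>mu_{n,i} = E_0 (Y_i^2 - tau_i/n)_+ where under theta = 0, Y_i = n^{-1/2} z, z ~ N(0,1).\<close>
definition mu :: "real \<Rightarrow> real \<Rightarrow> nat \<Rightarrow> nat \<Rightarrow> real" where
  "mu p s n i = (\<integral>z. max 0 ((z / sqrt (real n))\<^sup>2 - tau p s n i / real n) \<partial>(density lborel std_normal_density))"

definition Jstar :: "real \<Rightarrow> real \<Rightarrow> nat \<Rightarrow> nat" where
  "Jstar p s n = (GREATEST J::nat. 2 ^ J * real (m3 p s n) \<le> real n powr (1 / (4 * s)) * ln (real n))"

definition Qhat3 :: "real \<Rightarrow> real \<Rightarrow> nat \<Rightarrow> (nat \<Rightarrow> real) \<Rightarrow> real" where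
  "Qhat3 p s n Y =
     (\<Sum>i = 1..m3 p s n. (Y i)\<^sup>2 - 1 / real n)
   + (\<Sum>i = m3 p s n + 1 .. 2 ^ Jstar p s n * m3 p s n.
        max 0 ((Y i)\<^sup>2 - tau p s n i / real n) - mu p s n i)"

definition gauss_noise :: "'a measure \<Rightarrow> (nat \<Rightarrow> 'a \<Rightarrow> real) \<Rightarrow> bool" where
  "gauss_noise P z \<longleftrightarrow> prob_space P \<and> prob_space.indep_vars P (\<lambda>_. borel) z UNIV
     \<and> (\<forall>i. distributed P lborel (z i) std_normal_density)"

definition risk3 :: "'a measure \<Rightarrow> (nat \<Rightarrow> 'a \<Rightarrow> real) \<Rightarrow> real \<Rightarrow> real \<Rightarrow> nat \<Rightarrow> (nat \<Rightarrow> real) \<Rightarrow> ennreal" where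
  "risk3 P z p s n \<theta> =
     (\<integral>\<^sup>+ \<omega>. ennreal ((Qhat3 p s n (\<lambda>i. \<theta> i + z i \<omega> / sqrt (real n)) - Qfun \<theta>)\<^sup>2) \<partial>P)"

end

theory Submission
  imports Defs
begin

text \<open>
  The hypotheses force \<open>p > 1\<close> and \<open>1 \<le> r < 2\<close> for \<open>r = p / (1 + 2 p s)\<close>. Rescaling by \<open>n\<close> turns the
  terms of the estimator into centred values of \<open>f(x) = (x\<^sup>2 - \<tau>)\<^sub>+\<close> at \<open>z + t\<close> with
  \<open>t = \<theta>\<^sub>i n\<^bsup>1/2\<^esup>\<close>. For a standard Gaussian \<open>z\<close> the gain \<open>E f(z + t) - E f(z)\<close> differs from \<open>t\<^sup>2\<close> by at
  most \<open>min (4 t\<^sup>2) \<tau>\<close>, and \<open>f(z + t)\<close> has variance of order \<open>exp (- 2 \<tau> / 5) + t\<^sup>2\<close>.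

  Both balls lie in the set of sequences whose dyadic blocks satisfy
  \<open>\<Sum>\<^sub>k |\<theta>\<^sub>j\<^sub>,\<^sub>k|\<^sup>p \<le> M\<^sup>p 2\<^bsup>-jps\<^esup>\<close>. With \<open>m = m\<^sub>3 \<approx> n\<^bsup>r\<^esup>\<close>, independence bounds the variance by a constant times
  \<open>m / n\<^sup>2 + 1 / n\<close>. Interpolating \<open>min (t\<^sup>2) \<tau> \<le> |t|\<^sup>p \<tau>\<^bsup>1-p/2\<^esup>\<close> bounds the bias of the thresholded part
  by a constant times \<open>n\<^bsup>p/2-1\<^esup> m\<^bsup>-ps\<^esup>\<close>, and the truncation at \<open>N = 2\<^bsup>J\<^esup> m \<ge> n\<^bsup>1/(4s)\<^esup> / 2\<close> costs a bias of
  order \<open>N\<^bsup>-2s\<^esup>\<close>, hence \<open>n\<^bsup>-1/2\<^esup>\<close>. Each contribution to the risk is therefore \<open>O(n\<^bsup>r-2\<^esup>)\<close>.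
\<close>

section \<open>Thresholded squares of a shifted standard Gaussian\<close>

abbreviation std_gauss :: "real measure" where
  "std_gauss \<equiv> density lborel std_normal_density"

interpretation std_gauss: prob_space std_gauss
  by (rule prob_space_normal_density) simp

lemma std_gauss_UNIV [simp]: "measure std_gauss UNIV = 1"
  using std_gauss.prob_space by simp

lemma integrable_std_gauss_iff:
  fixes f :: "real \<Rightarrow> real"
  assumes [measurable]: "f \<in> borel_measurable borel"
  shows "integrable std_gauss f \<longleftrightarrow> integrable lborel (\<lambda>x. std_normal_density x * f x)"
  by (subst integrable_real_density) auto

lemma integral_std_gauss:
  fixes f :: "real \<Rightarrow> real"
  assumes [measurable]: "f \<in> borel_measurable borel"
  shows "(\<integral>x. f x \<partial>std_gauss) = (\<integral>x. std_normal_density x * f x \<partial>lborel)"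
  by (subst integral_real_density) auto

lemma std_gauss_integrable_power: "integrable std_gauss (\<lambda>x. x ^ k)"
  by (simp add: integrable_std_gauss_iff integrable_std_normal_moment)

lemma std_gauss_moments:
  "(\<integral>x. x \<partial>std_gauss) = 0" "(\<integral>x. x\<^sup>2 \<partial>std_gauss) = 1"
  "(\<integral>x. x^3 \<partial>std_gauss) = 0" "(\<integral>x. x^4 \<partial>std_gauss) = 3"
  using integral_std_normal_moment_odd[of 0] integral_std_normal_moment_odd[of 1]
    integral_std_normal_moment_even[of 1] integral_std_normal_moment_even[of 2]
  by (simp_all add: integral_std_gauss fact_numeral eval_nat_numeral)

text \<open>Every polynomial expectation below has degree at most four and is brought to this shape,
  with vanishing coefficients written out as explicit zeros.\<close>

lemma std_gauss_integrable_poly4: 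
  "integrable std_gauss (\<lambda>x. a + b * x + c * x\<^sup>2 + d * x^3 + e * x^4)"
  using std_gauss_integrable_power[of 1]
  by (intro Bochner_Integration.integrable_add integrable_mult_right std_gauss_integrable_power
      std_gauss.integrable_const) auto

lemma std_gauss_integral_poly4:
  "(\<integral>x. a + b * x + c * x\<^sup>2 + d * x^3 + e * x^4 \<partial>std_gauss) = a + c + 3 * e"
proof -
  have i: "integrable std_gauss (\<lambda>x. x)"
    using std_gauss_integrable_power[of 1] by simp
  show ?thesis
    by (simp add: i std_gauss_integrable_power std_gauss_moments)
qed

text \<open>The difference of the two sides vanishes at 0 and has derivative
  \<open>x * sinh x\<close>.\<close>

lemma sinh_le_self_mult_cosh:
  fixes x :: real assumes "0 \<le> x" shows "sinh x \<le> x * cosh x"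
proof -
  have "(\<lambda>x. x * cosh x - sinh x) 0 \<le> (\<lambda>x::real. x * cosh x - sinh x) x"
  proof (rule DERIV_nonneg_imp_nondecreasing[OF assms])
    fix y :: real assume "0 \<le> y" "y \<le> x"
    then show "\<exists>d. ((\<lambda>x. x * cosh x - sinh x) has_real_derivative d) (at y) \<and> 0 \<le> d"
      by (intro exI[of _ "y * sinh y"]) (auto intro!: derivative_eq_intros)
  qed
  then show ?thesis by simp
qed

text \<open>Half-angle formula: \<open>cosh x - 1\<close> is twice the square of
  \<open>sinh (x / 2)\<close>. Keeping \<open>cosh x\<close> on the right lets the bound, once
  multiplied by the Gaussian weight, be integrated exactly as a shifted moment.\<close>

lemma cosh_minus_one_le:
  fixes x :: real shows "cosh x - 1 \<le> x\<^sup>2 / 2 * cosh x"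
proof -
  define y where "y = \<bar>x\<bar> / 2"
  have c: "cosh x = cosh (2 * y)" by (simp add: y_def)
  have "cosh x - 1 = 2 * (sinh y)\<^sup>2"
    unfolding c cosh_double using hyperbolic_pythagoras[of y] by (simp add: cosh_square_eq)
  also have "\<dots> \<le> 2 * (y * cosh y)\<^sup>2"
    using sinh_le_self_mult_cosh[of y] by (intro mult_left_mono power_mono) (auto simp: y_def)
  also have "\<dots> = x\<^sup>2 / 4 * (cosh x + 1)"
    unfolding c cosh_double by (simp add: y_def power_mult_distrib sinh_square_eq field_simps)
  also have "\<dots> \<le> x\<^sup>2 / 4 * (2 * cosh x)"
    using cosh_real_ge_1[of x] by (intro mult_left_mono) auto
  finally show ?thesis by (simp add: mult.commute)
qed

text \<open>The weight is the average of the densities of \<open>N(t,1)\<close> and \<open>N(-t,1)\<close> relative to \<open>N(0,1)\<close>.\<close>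
lemma std_gauss_even_shift:
  fixes f :: "real \<Rightarrow> real"
  assumes [measurable]: "f \<in> borel_measurable borel"
    and even: "\<And>x. f (- x) = f x"
    and int: "integrable std_gauss (\<lambda>x. f (x + t))"
  shows "has_bochner_integral std_gauss (\<lambda>x. f x * (exp (- t\<^sup>2 / 2) * cosh (t * x)))
    (\<integral>x. f (x + t) \<partial>std_gauss)"
proof -
  let ?h = "\<lambda>x. std_normal_density x * f (x + t)"
  let ?I = "\<integral>x. f (x + t) \<partial>std_gauss"
  have h: "has_bochner_integral lborel ?h ?I"
    using int by (simp add: integrable_std_gauss_iff integral_std_gauss has_bochner_integral_iff)
  have shift: "has_bochner_integral lborel (\<lambda>x. std_normal_density (x - t) * f x) ?I"
    using h lborel_has_bochner_integral_real_affine_iff[of 1 ?h ?I "-t"]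
    by simp
  \<comment> \<open>Reflection turns the density of N(t,1) into that of N(-t,1), while the even
    \<open>f\<close> is unchanged. Averaging the two densities then produces
    \<open>cosh\<close>.\<close>
  have refl: "has_bochner_integral lborel (\<lambda>x. std_normal_density (- x - t) * f x) ?I"
    using shift lborel_has_bochner_integral_real_affine_iff[of "-1" "\<lambda>x. std_normal_density (x - t) * f x" ?I 0]
    by (simp add: even)
  have "has_bochner_integral lborel (\<lambda>x. (std_normal_density (x - t) * f x + std_normal_density (- x - t) * f x) / 2)
     ((?I + ?I) / 2)"
    by (intro has_bochner_integral_divide_zero has_bochner_integral_add shift refl)
  moreover have "(std_normal_density (x - t) * f x + std_normal_density (- x - t) * f x) / 2
     = std_normal_density x * (f x * (exp (- t\<^sup>2 / 2) * cosh (t * x)))" for x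
  proof -
    have 1: "exp (- (x - t)\<^sup>2 / 2) = exp (- x\<^sup>2 / 2) * exp (- t\<^sup>2 / 2) * exp (t * x)"
      by (simp add: exp_add[symmetric] power2_eq_square field_simps)
    have 2: "exp (- (- x - t)\<^sup>2 / 2) = exp (- x\<^sup>2 / 2) * exp (- t\<^sup>2 / 2) * exp (- (t * x))"
      by (simp add: exp_add[symmetric] power2_eq_square field_simps)
    show ?thesis
      unfolding std_normal_density_def 1 2 cosh_field_def by (simp add: field_simps)
  qed
  ultimately have "has_bochner_integral lborel
     (\<lambda>x. std_normal_density x * (f x * (exp (- t\<^sup>2 / 2) * cosh (t * x)))) ?I"
    by simp
  moreover have "(\<lambda>x. f x * (exp (- t\<^sup>2 / 2) * cosh (t * x))) \<in> borel_measurable borel"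
    unfolding cosh_field_def by measurable
  ultimately show ?thesis
    by (simp only: has_bochner_integral_iff integrable_std_gauss_iff integral_std_gauss)
qed

section \<open>Mean and variance of a thresholded square\<close>

definition soft_sq :: "real \<Rightarrow> real \<Rightarrow> real" where
  "soft_sq \<tau> x = max 0 (x\<^sup>2 - \<tau>)"

lemma soft_sq_measurable [measurable]: "soft_sq \<tau> \<in> borel_measurable borel"
  unfolding soft_sq_def by measurable

lemma soft_sq_bounds:
  assumes "0 \<le> \<tau>"
  shows "0 \<le> soft_sq \<tau> x" "soft_sq \<tau> x \<le> x\<^sup>2" "x\<^sup>2 - \<tau> \<le> soft_sq \<tau> x"
  using assms by (auto simp: soft_sq_def)

text \<open>The map from \<open>u\<close> to \<open>max 0 (u - \<tau>)\<close> is 1-Lipschitz; here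
  \<open>u\<close> is a square.\<close>

lemma soft_sq_diff_le: "\<bar>soft_sq \<tau> x - soft_sq \<tau> y\<bar> \<le> \<bar>x\<^sup>2 - y\<^sup>2\<bar>"
  by (auto simp: soft_sq_def max_def)

lemma integrable_shift_square: "integrable std_gauss (\<lambda>x. (x + t)\<^sup>2)"
  and integral_shift_square: "(\<integral>x. (x + t)\<^sup>2 \<partial>std_gauss) = 1 + t\<^sup>2"
proof -
  have *: "(x + t)\<^sup>2 = t\<^sup>2 + 2 * t * x + 1 * x\<^sup>2 + 0 * x^3 + 0 * x^4" for x
    by (simp add: power2_eq_square algebra_simps)
  show "integrable std_gauss (\<lambda>x. (x + t)\<^sup>2)"
    unfolding * by (rule std_gauss_integrable_poly4)
  show "(\<integral>x. (x + t)\<^sup>2 \<partial>std_gauss) = 1 + t\<^sup>2"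
    unfolding * std_gauss_integral_poly4 by simp
qed

lemma integrable_shift_fourth: "integrable std_gauss (\<lambda>x. (x + t)^4)"
  and integral_shift_fourth: "(\<integral>x. (x + t)^4 \<partial>std_gauss) = 3 + 6 * t\<^sup>2 + t^4"
proof -
  have *: "(x + t)^4 = t^4 + 4 * t^3 * x + 6 * t\<^sup>2 * x\<^sup>2 + 4 * t * x^3 + 1 * x^4" for x
    by (simp add: eval_nat_numeral algebra_simps)
  show "integrable std_gauss (\<lambda>x. (x + t)^4)"
    unfolding * by (rule std_gauss_integrable_poly4)
  show "(\<integral>x. (x + t)^4 \<partial>std_gauss) = 3 + 6 * t\<^sup>2 + t^4"
    unfolding * std_gauss_integral_poly4 by simp
qed

lemma integrable_soft_sq_shift:
  assumes "0 \<le> \<tau>" shows "integrable std_gauss (\<lambda>x. soft_sq \<tau> (x + t))"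
  by (rule Bochner_Integration.integrable_bound[OF integrable_shift_square[of t]])
     (use soft_sq_bounds[OF assms] in auto)

lemma integrable_soft_sq:
  assumes "0 \<le> \<tau>" shows "integrable std_gauss (soft_sq \<tau>)"
  using integrable_soft_sq_shift[OF assms, of 0] by simp

lemma integrable_soft_sq_shift_square:
  assumes "0 \<le> \<tau>" shows "integrable std_gauss (\<lambda>x. (soft_sq \<tau> (x + t))\<^sup>2)"
proof (rule Bochner_Integration.integrable_bound[OF integrable_shift_fourth[of t]])
  have "(soft_sq \<tau> x)\<^sup>2 \<le> (x\<^sup>2)\<^sup>2" for x
    using soft_sq_bounds[OF assms, of x] by (intro power_mono) auto
  then show "AE x in std_gauss. norm ((soft_sq \<tau> (x + t))\<^sup>2) \<le> norm ((x + t)^4)"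
    by (simp add: power_mult[symmetric])
qed auto

text \<open>This is \<open>n\<close> times the mean of one centred summand of the estimator when the
  rescaled coefficient is \<open>t\<close>; the value it should estimate is
  \<open>t\<^sup>2\<close>.\<close>

definition soft_gain :: "real \<Rightarrow> real \<Rightarrow> real" where
  "soft_gain \<tau> t = (\<integral>x. soft_sq \<tau> (x + t) \<partial>std_gauss) - (\<integral>x. soft_sq \<tau> x \<partial>std_gauss)"

text \<open>Thresholding lowers a square by at most \<open>\<tau>\<close>, so the shifted mean lies
  between \<open>1 + t\<^sup>2 - \<tau>\<close> and \<open>1 + t\<^sup>2\<close>, and the unshifted
  one between \<open>1 - \<tau>\<close> and 1.\<close>

lemma soft_gain_le_threshold:
  assumes "0 \<le> \<tau>" shows "\<bar>soft_gain \<tau> t - t\<^sup>2\<bar> \<le> \<tau>"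
proof -
  have *: "(\<integral>x. soft_sq \<tau> (x + t) \<partial>std_gauss) \<le> 1 + t\<^sup>2 \<and>
     1 + t\<^sup>2 - \<tau> \<le> (\<integral>x. soft_sq \<tau> (x + t) \<partial>std_gauss)" for t
  proof
    show "(\<integral>x. soft_sq \<tau> (x + t) \<partial>std_gauss) \<le> 1 + t\<^sup>2"
      unfolding integral_shift_square[symmetric]
      by (intro integral_mono integrable_soft_sq_shift integrable_shift_square assms soft_sq_bounds)
    have "(\<integral>x. (x + t)\<^sup>2 - \<tau> \<partial>std_gauss) \<le> (\<integral>x. soft_sq \<tau> (x + t) \<partial>std_gauss)"
      using soft_sq_bounds[OF assms]
      by (intro integral_mono Bochner_Integration.integrable_diff integrable_soft_sq_shift 
         integrable_shift_square assms) auto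
    also have "(\<integral>x. (x + t)\<^sup>2 - \<tau> \<partial>std_gauss) = 1 + t\<^sup>2 - \<tau>"
      by (subst Bochner_Integration.integral_diff)
         (auto simp: integrable_shift_square integral_shift_square)
    finally show "1 + t\<^sup>2 - \<tau> \<le> (\<integral>x. soft_sq \<tau> (x + t) \<partial>std_gauss)" .
  qed
  from *[of t] *[of 0] show ?thesis by (auto simp: soft_gain_def)
qed

text \<open>By symmetry the shifts by \<open>t\<close> and \<open>- t\<close> give the same expectation, and \<open>soft_sq \<tau>\<close> is convex.\<close>
lemma soft_gain_nonneg:
  assumes "0 \<le> \<tau>" shows "0 \<le> soft_gain \<tau> t"
proof -
  let ?f = "soft_sq \<tau>"
  have refl: "(\<integral>x. ?f (x + (- t)) \<partial>std_gauss) = (\<integral>x. ?f (x + t) \<partial>std_gauss)"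
  proof -
    have "(\<integral>x. ?f (x + (- t)) \<partial>std_gauss) = (\<integral>x. std_normal_density x * ?f (x + (- t)) \<partial>lborel)"
      by (simp add: integral_std_gauss)
    also have "\<dots> = (\<integral>x. std_normal_density x * ?f (x + t) \<partial>lborel)"
      by (subst lborel_integral_real_affine[where c="-1" and t=0])
        (auto simp: std_normal_density_def soft_sq_def power2_eq_square algebra_simps)
    finally show ?thesis by (simp add: integral_std_gauss)
  qed
  have "2 * ?f x \<le> ?f (x + t) + ?f (x + (- t))" for x
  proof -
    have "(x+t)\<^sup>2 + (x-t)\<^sup>2 \<ge> 2 * x\<^sup>2" by (simp add: power2_eq_square algebra_simps)
    then show ?thesis by (auto simp: soft_sq_def max_def)
  qed
  then have "(\<integral>x. 2 * ?f x \<partial>std_gauss) \<le> (\<integral>x. ?f (x + t) + ?f (x + (- t)) \<partial>std_gauss)"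
    by (intro integral_mono Bochner_Integration.integrable_add integrable_soft_sq_shift
        integrable_mult_right integrable_soft_sq assms) auto
  also have "\<dots> = 2 * (\<integral>x. ?f (x + t) \<partial>std_gauss)"
    by (subst Bochner_Integration.integral_add) (simp_all only: integrable_soft_sq_shift assms refl)
  finally show ?thesis by (simp add: soft_gain_def)
qed

text \<open>The constant is uniform in \<open>\<tau>\<close>. For small \<open>t\<close> the shift
  is moved into the even weight \<open>?w\<close>; bounding \<open>soft_sq\<close> by the square and
  \<open>?w - 1\<close> by a quadratic multiple of \<open>?w\<close> leaves half of
  \<open>t\<^sup>2\<close> times a shifted fourth moment, which is at most 10. For large
  \<open>t\<close> the crude bound \<open>1 + t\<^sup>2\<close> suffices.\<close>

lemma soft_gain_le:
  assumes "0 \<le> \<tau>" shows "soft_gain \<tau> t \<le> 5 * t\<^sup>2"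
proof (cases "\<bar>t\<bar> \<le> 1")
  case True
  then have t2: "t\<^sup>2 \<le> 1" by (simp add: abs_square_le_1)
  let ?f = "soft_sq \<tau>" and ?w = "\<lambda>x. exp (- t\<^sup>2 / 2) * cosh (t * x)"
  have 1: "has_bochner_integral std_gauss (\<lambda>x. ?f x * ?w x) (\<integral>x. ?f (x + t) \<partial>std_gauss)"
    by (rule std_gauss_even_shift) (auto simp: integrable_soft_sq_shift assms, simp add: soft_sq_def)
  have 2: "has_bochner_integral std_gauss (\<lambda>x. x^4 * ?w x) (\<integral>x. (x + t)^4 \<partial>std_gauss)"
    by (rule std_gauss_even_shift) (auto simp: integrable_shift_fourth)
  have "?f x * ?w x - ?f x \<le> t\<^sup>2 / 2 * (x^4 * ?w x)" for x
  proof -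
    have e: "exp (- t\<^sup>2 / 2) \<le> 1" by simp
    \<comment> \<open>The subtracted 1 is replaced by the smaller exponential factor.\<close>
    have "?w x - 1 \<le> exp (- t\<^sup>2 / 2) * (cosh (t * x) - 1)"
      using e by (simp add: algebra_simps)
    also have "\<dots> \<le> exp (- t\<^sup>2 / 2) * ((t * x)\<^sup>2 / 2 * cosh (t * x))"
      by (intro mult_left_mono cosh_minus_one_le) auto
    finally have w: "?w x - 1 \<le> (t * x)\<^sup>2 / 2 * ?w x" by (simp add: algebra_simps)
    have "?f x * (?w x - 1) \<le> ?f x * ((t * x)\<^sup>2 / 2 * ?w x)"
      by (intro mult_left_mono w soft_sq_bounds assms)
    also have "\<dots> \<le> x\<^sup>2 * ((t * x)\<^sup>2 / 2 * ?w x)"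
      by (intro mult_right_mono soft_sq_bounds assms) auto
    also have "\<dots> = t\<^sup>2 / 2 * (x^4 * ?w x)"
      by (simp add: power_mult_distrib eval_nat_numeral)
    finally show ?thesis by (simp add: algebra_simps)
  qed
  then have "(\<integral>x. ?f x * ?w x - ?f x \<partial>std_gauss) \<le> (\<integral>x. t\<^sup>2 / 2 * (x^4 * ?w x) \<partial>std_gauss)"
    using 1 2 by (intro integral_mono Bochner_Integration.integrable_diff integrable_mult_right integrable_soft_sq assms)
      (auto simp: has_bochner_integral_iff)
  also have "(\<integral>x. ?f x * ?w x - ?f x \<partial>std_gauss) = soft_gain \<tau> t"
    unfolding soft_gain_def using 1 by (subst Bochner_Integration.integral_diff) (auto simp: has_bochner_integral_iff integrable_soft_sq assms)
  also have "(\<integral>x. t\<^sup>2 / 2 * (x^4 * ?w x) \<partial>std_gauss) = t\<^sup>2 / 2 * (3 + 6 * t\<^sup>2 + t^4)"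
    using 2 by (simp add: has_bochner_integral_iff integral_shift_fourth del: times_divide_eq_left)
  also have "\<dots> \<le> t\<^sup>2 / 2 * 10"
  proof -
    have "t^4 = t\<^sup>2 * t\<^sup>2" by (simp add: eval_nat_numeral)
    also have "\<dots> \<le> 1" using t2 by (intro mult_le_one) auto
    finally show ?thesis using t2 by (intro mult_left_mono) auto
  qed
  finally show ?thesis by simp
next
  case False
  then have "t\<^sup>2 \<ge> 1" by (metis abs_square_le_1 linear)
  have "(\<integral>x. soft_sq \<tau> (x + t) \<partial>std_gauss) \<le> 1 + t\<^sup>2"
    unfolding integral_shift_square[symmetric]
    by (intro integral_mono integrable_soft_sq_shift integrable_shift_square assms soft_sq_bounds)
  moreover have "0 \<le> (\<integral>x. soft_sq \<tau> x \<partial>std_gauss)"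
    by (intro integral_nonneg_AE) (auto simp: soft_sq_bounds assms)
  ultimately show ?thesis using \<open>t\<^sup>2 \<ge> 1\<close> by (simp add: soft_gain_def)
qed

text \<open>A gain between 0 and \<open>5 * t\<^sup>2\<close> differs from \<open>t\<^sup>2\<close>
  by at most \<open>4 * t\<^sup>2\<close>; the other bound is
  \<open>soft_gain_le_threshold\<close>.\<close>

lemma soft_gain_bias:
  assumes "0 \<le> \<tau>" shows "\<bar>soft_gain \<tau> t - t\<^sup>2\<bar> \<le> min (4 * t\<^sup>2) \<tau>"
  using soft_gain_le[OF assms, of t] soft_gain_nonneg[OF assms, of t] soft_gain_le_threshold[OF assms, of t]
  by (auto simp: abs_le_iff)

text \<open>A Chernoff bound. The rate 2/5 lies below 1/2, so that the exponential moment of the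
  square is finite, and above \<open>ln 2 / 2\<close>, so that the bound is summable over the
  thresholds \<open>tau\<close>.\<close>

lemma soft_sq_second_moment:
  shows "(\<integral>x. (soft_sq \<tau> x)\<^sup>2 \<partial>std_gauss) \<le> 28 * exp (- 2 * \<tau> / 5)"
proof -
  \<comment> \<open>For nonnegative \<open>u\<close> this keeps only the quadratic Taylor term of
    the exponential.\<close>
  have pos: "(max 0 u)\<^sup>2 \<le> 25/2 * exp (2/5 * u)" for u :: real
  proof (cases "0 \<le> u")
    case True
    have "1 + 2/5 * u + (2/5*u)\<^sup>2 / 2 \<le> exp (2/5 * u)"
      using True by (intro exp_lower_Taylor_quadratic) auto
    then show ?thesis using True by (simp add: power2_eq_square)
  qed auto
  \<comment> \<open>The exponents add up to minus one tenth of the square of \<open>x\<close>, which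
    belongs to a Gaussian of variance 5.\<close>
  have eq: "std_normal_density x * exp (2/5 * x\<^sup>2) = sqrt 5 * normal_density 0 (sqrt 5) x" for x
    using real_sqrt_mult[of 2 5]
    by (simp add: normal_density_def real_sqrt_mult exp_add[symmetric] field_simps)
  have "integrable lborel (\<lambda>x. std_normal_density x * exp (2/5 * x\<^sup>2))"
    unfolding eq by (intro integrable_mult_right integrable_normal_density) auto
  then have int: "integrable std_gauss (\<lambda>x. exp (2/5 * x\<^sup>2))"
    by (simp add: integrable_std_gauss_iff)
  have "(\<integral>x. exp (2/5 * x\<^sup>2) \<partial>std_gauss) = (\<integral>x. std_normal_density x * exp (2/5 * x\<^sup>2) \<partial>lborel)"
    by (simp add: integral_std_gauss)
  also have "\<dots> = sqrt 5"
    unfolding eq by simp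
  finally have E5: "(\<integral>x. exp (2/5 * x\<^sup>2) \<partial>std_gauss) = sqrt 5" .
  have "(\<integral>x. (soft_sq \<tau> x)\<^sup>2 \<partial>std_gauss) \<le> (\<integral>x. 25/2 * exp (- 2 * \<tau> / 5) * exp (2/5 * x\<^sup>2) \<partial>std_gauss)"
  proof (rule integral_mono_AE')
    show "AE x in std_gauss. (soft_sq \<tau> x)\<^sup>2 \<le> 25/2 * exp (- 2 * \<tau> / 5) * exp (2/5 * x\<^sup>2)"
    proof (intro AE_I2)
      fix x
      have "exp (2/5 * (x\<^sup>2 - \<tau>)) = exp (- 2 * \<tau> / 5) * exp (2/5 * x\<^sup>2)"
        by (simp add: exp_add[symmetric] field_simps)
      then show "(soft_sq \<tau> x)\<^sup>2 \<le> 25/2 * exp (- 2 * \<tau> / 5) * exp (2/5 * x\<^sup>2)"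
        using pos[of "x\<^sup>2 - \<tau>"] unfolding soft_sq_def by (simp only: mult.assoc)
    qed
  qed (use int in auto)
  also have "\<dots> = 25/2 * exp (- 2 * \<tau> / 5) * sqrt 5"
    unfolding E5[symmetric] by (rule integral_mult_right_zero)
  \<comment> \<open>The rational 56/25 slightly exceeds \<open>sqrt 5\<close> and makes the constant
    28.\<close>
  also have "\<dots> \<le> 25/2 * exp (- 2 * \<tau> / 5) * (56/25)"
    by (intro mult_left_mono real_le_lsqrt) (auto simp: power2_eq_square)
  finally show ?thesis by simp
qed

text \<open>The variance is at most the mean square about any constant. For small \<open>t\<close>
  the constant is 0 and the shifted value is compared with the unshifted one. For large
  \<open>t\<close> the second moment would grow like \<open>t^4\<close>, so the constant is
  \<open>soft_sq \<tau> t\<close>; the Lipschitz bound then leaves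
  \<open>4 * t\<^sup>2 + 3\<close>.\<close>

lemma soft_sq_variance:
  assumes "0 \<le> \<tau>"
  shows "std_gauss.variance (\<lambda>x. soft_sq \<tau> (x + t)) \<le> 56 * exp (- 2 * \<tau> / 5) + 10 * t\<^sup>2"
proof -
  let ?f = "\<lambda>x. soft_sq \<tau> (x + t)"
  note I = integrable_soft_sq_shift[OF assms, of t] integrable_soft_sq_shift_square[OF assms, of t]
  have var_le: "std_gauss.variance ?f \<le> (\<integral>x. (?f x - c)\<^sup>2 \<partial>std_gauss)" for c
  proof -
    have "std_gauss.variance ?f = (\<integral>x. (?f x)\<^sup>2 \<partial>std_gauss) - (\<integral>x. ?f x \<partial>std_gauss)\<^sup>2"
      using I by (rule std_gauss.variance_eq)
    also have "\<dots> \<le> (\<integral>x. (?f x)\<^sup>2 \<partial>std_gauss) - 2 * c * (\<integral>x. ?f x \<partial>std_gauss) + c\<^sup>2"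
      using zero_le_power2[of "(\<integral>x. ?f x \<partial>std_gauss) - c"] by (simp add: power2_eq_square algebra_simps)
    also have "\<dots> = (\<integral>x. (?f x)\<^sup>2 - 2 * c * ?f x + c\<^sup>2 \<partial>std_gauss)"
      using I by simp
    finally show ?thesis by (simp add: power2_eq_square algebra_simps)
  qed
  show ?thesis
  proof (cases "\<bar>t\<bar> \<le> 1")
    case True
    then have t2: "t\<^sup>2 \<le> 1" by (simp add: abs_square_le_1)
    have "(\<integral>x. (?f x)\<^sup>2 \<partial>std_gauss) \<le> (\<integral>x. 2 * (soft_sq \<tau> x)\<^sup>2 + (2 * t^4 + 8 * t^3 * x + 8 * t\<^sup>2 * x\<^sup>2 + 0 * x^3 + 0 * x^4) \<partial>std_gauss)"
    proof (intro integral_mono I std_gauss_integrable_poly4 Bochner_Integration.integrable_add integrable_mult_right)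
      show "integrable std_gauss (\<lambda>x. (soft_sq \<tau> x)\<^sup>2)"
        using integrable_soft_sq_shift_square[OF assms, of 0] by simp
      fix x
      have "(?f x)\<^sup>2 \<le> 2 * (soft_sq \<tau> x)\<^sup>2 + 2 * (?f x - soft_sq \<tau> x)\<^sup>2"
        using zero_le_power2[of "?f x - 2 * soft_sq \<tau> x"] by (simp add: power2_eq_square algebra_simps)
      also have "(?f x - soft_sq \<tau> x)\<^sup>2 \<le> ((x + t)\<^sup>2 - x\<^sup>2)\<^sup>2"
        using soft_sq_diff_le[of \<tau> "x + t" x] by (simp only: abs_le_square_iff)
      finally show "(?f x)\<^sup>2 \<le> 2 * (soft_sq \<tau> x)\<^sup>2 + (2 * t^4 + 8 * t^3 * x + 8 * t\<^sup>2 * x\<^sup>2 + 0 * x^3 + 0 * x^4)"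
        by (simp add: eval_nat_numeral algebra_simps)
    qed
    also have "\<dots> = 2 * (\<integral>x. (soft_sq \<tau> x)\<^sup>2 \<partial>std_gauss) + (2 * t^4 + 8 * t\<^sup>2)"
      using integrable_soft_sq_shift_square[OF assms, of 0]
      by (subst Bochner_Integration.integral_add[OF _ std_gauss_integrable_poly4],
          simp, subst std_gauss_integral_poly4, simp)
    also have "\<dots> \<le> 56 * exp (- 2 * \<tau> / 5) + 10 * t\<^sup>2"
    proof -
      have "t^4 = t\<^sup>2 * t\<^sup>2" by (simp add: eval_nat_numeral)
      also have "\<dots> \<le> t\<^sup>2 * 1" using t2 by (intro mult_left_mono) auto
      finally show ?thesis using soft_sq_second_moment[of \<tau>] by simp
    qed
    finally show ?thesis using var_le[of 0] by simp
  next
    case False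
    then have t2: "t\<^sup>2 \<ge> 1" by (metis abs_square_le_1 linear)
    have "(\<integral>x. (?f x - soft_sq \<tau> t)\<^sup>2 \<partial>std_gauss)
        \<le> (\<integral>x. 0 + 0 * x + 4 * t\<^sup>2 * x\<^sup>2 + 4 * t * x^3 + 1 * x^4 \<partial>std_gauss)"
    proof (rule integral_mono_AE'[OF std_gauss_integrable_poly4])
      have "(?f x - soft_sq \<tau> t)\<^sup>2 \<le> ((x + t)\<^sup>2 - t\<^sup>2)\<^sup>2" for x
        using soft_sq_diff_le[of \<tau> "x + t" t] by (simp only: abs_le_square_iff)
      also have "((x + t)\<^sup>2 - t\<^sup>2)\<^sup>2 = 0 + 0 * x + 4 * t\<^sup>2 * x\<^sup>2 + 4 * t * x^3 + 1 * x^4" for x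
        by (simp add: eval_nat_numeral algebra_simps)
      finally show "AE x in std_gauss. (?f x - soft_sq \<tau> t)\<^sup>2
          \<le> 0 + 0 * x + 4 * t\<^sup>2 * x\<^sup>2 + 4 * t * x^3 + 1 * x^4"
        by auto
      \<comment> \<open>The comparison rule also asks for a nonnegative majorant, here a perfect
        square.\<close>
      have "0 \<le> x\<^sup>2 * (x + 2 * t)\<^sup>2" for x by simp
      also have "x\<^sup>2 * (x + 2 * t)\<^sup>2 = 0 + 0 * x + 4 * t\<^sup>2 * x\<^sup>2 + 4 * t * x^3 + 1 * x^4" for x
        by (simp add: eval_nat_numeral algebra_simps)
      finally show "AE x in std_gauss. 0 \<le> 0 + 0 * x + 4 * t\<^sup>2 * x\<^sup>2 + 4 * t * x^3 + 1 * x^4"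
        by auto
    qed
    also have "\<dots> = 4 * t\<^sup>2 + 3"
      by (simp only: std_gauss_integral_poly4)
    finally have "std_gauss.variance ?f \<le> 10 * t\<^sup>2"
      using var_le[of "soft_sq \<tau> t"] t2 by simp
    also have "\<dots> \<le> 56 * exp (- 2 * \<tau> / 5) + 10 * t\<^sup>2" by simp
    finally show ?thesis .
  qed
qed

section \<open>Mean square error of a sum of independent variables\<close>

lemma (in prob_space) indep_vars_expectation_mult:
  fixes X :: "'i \<Rightarrow> 'a \<Rightarrow> real"
  assumes "indep_vars (\<lambda>_. borel) X I" "i \<in> I" "j \<in> I" "i \<noteq> j"
    and "integrable M (X i)" "integrable M (X j)"
  shows "integrable M (\<lambda>\<omega>. X i \<omega> * X j \<omega>)"
    and "expectation (\<lambda>\<omega>. X i \<omega> * X j \<omega>) = expectation (X i) * expectation (X j)"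
proof -
  have *: "indep_vars (\<lambda>_. borel) X {i, j}"
    using assms by (intro indep_vars_subset[OF assms(1)]) auto
  show "integrable M (\<lambda>\<omega>. X i \<omega> * X j \<omega>)"
    using indep_vars_integrable[OF _ *] assms by force
  show "expectation (\<lambda>\<omega>. X i \<omega> * X j \<omega>) = expectation (X i) * expectation (X j)"
    using indep_vars_lebesgue_integral[OF _ *] assms by force
qed

text \<open>The usual split into variance and squared bias: after centring, independence kills the
  cross products. The form with \<open>has_bochner_integral\<close> supplies the integrability
  needed to pass to the nonnegative integral in the risk.\<close>

lemma (in prob_space) indep_vars_mean_square_error:
  fixes X :: "'i \<Rightarrow> 'a \<Rightarrow> real"
  assumes ind: "indep_vars (\<lambda>_. borel) X A" and "finite A"
    and int: "\<And>i. i \<in> A \<Longrightarrow> integrable M (X i)"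
    and int2: "\<And>i. i \<in> A \<Longrightarrow> integrable M (\<lambda>\<omega>. (X i \<omega>)\<^sup>2)"
  shows "has_bochner_integral M (\<lambda>\<omega>. ((\<Sum>i\<in>A. X i \<omega>) - c)\<^sup>2)
    ((\<Sum>i\<in>A. variance (X i)) + ((\<Sum>i\<in>A. expectation (X i)) - c)\<^sup>2)"
proof -
  let ?e = "\<lambda>i. expectation (X i)"
  define Y where "Y = (\<lambda>i \<omega>. X i \<omega> - ?e i)"
  define b where "b = (\<Sum>i\<in>A. ?e i) - c"
  have indY: "indep_vars (\<lambda>_. borel) Y A"
    unfolding Y_def by (rule indep_vars_compose2[OF ind]) auto
  have Y: "integrable M (Y i)" "expectation (Y i) = 0" if "i \<in> A" for i
    using int[OF that] by (simp_all add: Y_def prob_space)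
  have prod: "has_bochner_integral M (\<lambda>\<omega>. Y i \<omega> * Y j \<omega>) (if i = j then variance (X i) else 0)"
    if "i \<in> A" "j \<in> A" for i j
  proof (cases "i = j")
    case True
    have "integrable M (\<lambda>\<omega>. (X i \<omega>)\<^sup>2 - 2 * ?e i * X i \<omega> + (?e i)\<^sup>2)"
      using int int2 that by auto
    then have "integrable M (\<lambda>\<omega>. (X i \<omega> - ?e i)\<^sup>2)"
      by (simp add: power2_eq_square algebra_simps)
    then show ?thesis
      using True by (simp add: has_bochner_integral_iff Y_def power2_eq_square)
  next
    case False
    then show ?thesis
      using indep_vars_expectation_mult[OF indY that False] Y that by (simp add: has_bochner_integral_iff)
  qed
  have "has_bochner_integral M
      (\<lambda>\<omega>. (\<Sum>i\<in>A. \<Sum>j\<in>A. Y i \<omega> * Y j \<omega>) + (2 * b * (\<Sum>i\<in>A. Y i \<omega>) + b\<^sup>2))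
      ((\<Sum>i\<in>A. \<Sum>j\<in>A. if i = j then variance (X i) else 0) + (2 * b * (\<Sum>i\<in>A. 0) + b\<^sup>2))"
    using Y by (intro has_bochner_integral_add has_bochner_integral_sum prod has_bochner_integral_mult_right)
      (auto simp: has_bochner_integral_iff prob_space)
  moreover have "(\<Sum>i\<in>A. \<Sum>j\<in>A. Y i \<omega> * Y j \<omega>) + (2 * b * (\<Sum>i\<in>A. Y i \<omega>) + b\<^sup>2)
      = ((\<Sum>i\<in>A. X i \<omega>) - c)\<^sup>2" for \<omega>
  proof -
    have "(\<Sum>i\<in>A. X i \<omega>) - c = (\<Sum>i\<in>A. Y i \<omega>) + b"
      by (simp add: Y_def b_def sum_subtractf)
    then show ?thesis
      by (simp only: sum_product[symmetric]) (simp add: power2_eq_square algebra_simps)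
  qed
  ultimately show ?thesis
    using \<open>finite A\<close> by (simp add: b_def)
qed

section \<open>Sequences with dyadic block bounds\<close>

lemma dyadic_floor:
  assumes "1 \<le> (m::nat)"
  obtains j where "2 ^ j \<le> m" "m < 2 ^ Suc j"
proof -
  have "2 ^ floor_log m \<le> m" "m < 2 ^ Suc (floor_log m)"
    using assms floor_log_exp2_le floor_log_exp2_gt by auto
  then show ?thesis by (rule that)
qed

lemma sum_dyadic_level:
  fixes a :: "nat \<Rightarrow> real"
  shows "sum a {2 ^ j..<2 ^ Suc j} = (\<Sum>k<2 ^ j. a (2 ^ j + k))"
proof -
  have "sum a {2 ^ j..<2 ^ Suc j} = sum a {0 + 2 ^ j..<2 ^ j + 2 ^ j}"
    by (simp add: mult_2)
  also have "\<dots> = (\<Sum>k<2 ^ j. a (2 ^ j + k))"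
    by (subst sum.shift_bounds_nat_ivl) (simp add: atLeast0LessThan add.commute)
  finally show ?thesis .
qed

text \<open>The range is enlarged to whole dyadic blocks, starting with the one containing
  \<open>m\<close>, and the block bounds form a geometric series. The bound does not depend on
  \<open>N\<close>, so it also controls infinite tails.\<close>

lemma sum_le_dyadic:
  fixes a :: "nat \<Rightarrow> real"
  assumes nn: "\<And>i. 1 \<le> i \<Longrightarrow> 0 \<le> a i" and "0 \<le> A" "0 < \<gamma>"
    and lev: "\<And>j. (\<Sum>k<2 ^ j. a (2 ^ j + k)) \<le> A * 2 powr (- real j * \<gamma>)"
    and "1 \<le> m"
  shows "sum a {m..N} \<le> 2 powr \<gamma> / (1 - 2 powr (- \<gamma>)) * A * real m powr (- \<gamma>)"
proof -
  define \<rho> where "\<rho> = 2 powr (- \<gamma>)"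
  have \<rho>: "0 < \<rho>" "\<rho> < 1" using \<open>0 < \<gamma>\<close> by (auto simp: \<rho>_def powr_less_one)
  have pw: "2 powr (- real j * \<gamma>) = \<rho> ^ j" for j
    by (simp add: \<rho>_def powr_realpow[symmetric] powr_powr mult.commute)
  obtain j where j: "2 ^ j \<le> m" "m < 2 ^ Suc j" using dyadic_floor[OF \<open>1 \<le> m\<close>] .
  \<comment> \<open>The block of \<open>m\<close> starts above \<open>m / 2\<close>, which costs the
    factor \<open>2 powr \<gamma>\<close>.\<close>
  have \<rho>j: "\<rho> ^ j \<le> 2 powr \<gamma> * real m powr (- \<gamma>)"
  proof -
    have "real m \<le> 2 ^ Suc j" using j by (metis less_imp_le of_nat_le_iff of_nat_numeral of_nat_power)
    then have "(2 ^ Suc j) powr (- \<gamma>) \<le> real m powr (- \<gamma>)"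
      using \<open>0 < \<gamma>\<close> \<open>1 \<le> m\<close> by (intro powr_mono2') auto
    moreover have "((2::real) ^ Suc j) powr (- \<gamma>) = 2 powr (- \<gamma>) * \<rho> ^ j"
      by (simp add: powr_mult pw[symmetric] powr_realpow[symmetric] powr_powr)
    ultimately have "2 powr \<gamma> * (2 powr (- \<gamma>) * \<rho> ^ j) \<le> 2 powr \<gamma> * real m powr (- \<gamma>)"
      by simp
    then show ?thesis by (simp add: mult.assoc[symmetric] powr_add[symmetric])
  qed
  \<comment> \<open>The exact partial geometric sum is kept so that the induction closes.\<close>
  have part: "sum a {2 ^ j..<2 ^ (j + d)} \<le> A * (\<rho> ^ j - \<rho> ^ (j + d)) / (1 - \<rho>)" for d
  proof (induction d)
    case (Suc d)
    have "sum a {2 ^ j..<2 ^ (j + Suc d)}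
       = sum a {2 ^ j..<2 ^ (j + d)} + sum a {2 ^ (j + d)..<2 ^ Suc (j + d)}"
      by (subst sum.atLeastLessThan_concat) (auto intro: power_increasing)
    also have "\<dots> \<le> A * (\<rho> ^ j - \<rho> ^ (j + d)) / (1 - \<rho>) + A * \<rho> ^ (j + d)"
      using Suc lev[of "j + d"] unfolding sum_dyadic_level pw by (rule add_mono)
    also have "\<dots> = A * (\<rho> ^ j - \<rho> ^ (j + Suc d)) / (1 - \<rho>)"
      using \<rho> by (simp add: field_simps)
    finally show ?case .
  qed auto
  have "sum a {m..N} \<le> sum a {2 ^ j..<2 ^ (j + Suc N)}"
  proof (rule sum_mono2)
    have "N < 2 ^ N" by (rule less_exp)
    also have "\<dots> \<le> 2 ^ (j + Suc N)" by (intro power_increasing) auto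
    finally have "N < 2 ^ (j + Suc N)" .
    then show "{m..N} \<subseteq> {2 ^ j..<2 ^ (j + Suc N)}" using j by auto
    have "1 \<le> (2::nat) ^ j" by simp
    then show "0 \<le> a b" if "b \<in> {2 ^ j..<2 ^ (j + Suc N)} - {m..N}" for b
      using that order_trans[OF \<open>1 \<le> 2 ^ j\<close>, of b] by (intro nn) auto
  qed auto
  also have "\<dots> \<le> A * (\<rho> ^ j - \<rho> ^ (j + Suc N)) / (1 - \<rho>)" by (rule part)
  also have "\<dots> \<le> A * \<rho> ^ j / (1 - \<rho>)"
    using \<rho> \<open>0 \<le> A\<close> by (intro divide_right_mono mult_left_mono) auto
  also have "\<dots> \<le> A * (2 powr \<gamma> * real m powr (- \<gamma>)) / (1 - \<rho>)"
    using \<rho> \<open>0 \<le> A\<close> \<rho>j by (intro divide_right_mono mult_left_mono) auto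
  finally show ?thesis
    by (simp add: \<rho>_def mult_ac)
qed

text \<open>This is the Besov ball with q infinite, its level condition raised to the power
  \<open>p\<close>. It serves as a common superset of both balls.\<close>

definition dyadic_ball :: "real \<Rightarrow> real \<Rightarrow> real \<Rightarrow> (nat \<Rightarrow> real) set" where
  "dyadic_ball p s M =
    {\<theta>. \<forall>j. (\<Sum>k<2 ^ j. \<bar>\<theta> (2 ^ j + k)\<bar> powr p) \<le> M powr p * 2 powr (- real j * (p * s))}"

section \<open>Embedding both balls and summing over the dyadic ball\<close>

lemma powr_inverse_le_iff:
  fixes x M q :: real
  assumes "0 < q" "0 \<le> x" "0 < M"
  shows "x powr (1 / q) \<le> M \<longleftrightarrow> x \<le> M powr q"
proof
  assume "x powr (1 / q) \<le> M"
  then have "(x powr (1 / q)) powr q \<le> M powr q" using assms by (intro powr_mono2) auto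
  then show "x \<le> M powr q" using assms by (simp add: powr_powr)
next
  assume "x \<le> M powr q"
  then have "x powr (1 / q) \<le> (M powr q) powr (1 / q)" using assms by (intro powr_mono2) auto
  then show "x powr (1 / q) \<le> M" using assms by (simp add: powr_powr)
qed

text \<open>A single level of a nonnegative series is at most its sum.\<close>

lemma Besov_ball_subset_dyadic_ball:
  assumes "0 < p" "0 < q" "0 < M"
  shows "Besov_ball p q \<alpha> M \<subseteq> dyadic_ball p (smooth_index \<alpha> p) M"
proof
  fix \<theta> assume \<theta>: "\<theta> \<in> Besov_ball p q \<alpha> M"
  define s where "s = smooth_index \<alpha> p"
  let ?L = "\<lambda>j. besov_level p s \<theta> j powr q"
  have sm: "summable ?L" and le: "(\<Sum>j. ?L j) powr (1/q) \<le> M"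
    using \<theta> by (auto simp: Besov_ball_def s_def)
  have "(\<Sum>k<2 ^ j. \<bar>\<theta> (2 ^ j + k)\<bar> powr p) \<le> M powr p * 2 powr (- real j * (p * s))" for j
  proof -
    let ?S = "\<Sum>k<2 ^ j. \<bar>\<theta> (2 ^ j + k)\<bar> powr p"
    have "?L j = (\<Sum>j\<in>{j}. ?L j)" by simp
    also have "\<dots> \<le> (\<Sum>j. ?L j)" by (rule sum_le_suminf[OF sm]) auto
    also have "\<dots> \<le> M powr q"
      using le assms by (subst (asm) powr_inverse_le_iff) (auto intro: suminf_nonneg[OF sm])
    finally have "?L j powr (1/q) \<le> M" using assms by (subst powr_inverse_le_iff) auto
    moreover have "0 \<le> besov_level p s \<theta> j" by (simp add: besov_level_def)
    ultimately have "besov_level p s \<theta> j \<le> M" using assms by (simp add: powr_powr)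
    then have "?S powr (1/p) \<le> M * 2 powr (- real j * s)"
      by (simp add: besov_level_def powr_minus field_simps)
    then have "?S \<le> (M * 2 powr (- real j * s)) powr p"
      using assms by (subst (asm) powr_inverse_le_iff) (auto intro: sum_nonneg)
    also have "\<dots> = M powr p * 2 powr (- real j * (p * s))"
      using assms by (simp add: powr_mult powr_powr mult_ac)
    finally show ?thesis .
  qed
  then show "\<theta> \<in> dyadic_ball p (smooth_index \<alpha> p) M"
    by (simp add: dyadic_ball_def s_def)
qed

text \<open>On block \<open>j\<close> the weight is at least its value at the left end
  \<open>2 ^ j\<close>, because \<open>s\<close> is nonnegative; the weighted block sum is part of
  the whole series.\<close>

lemma Lp_ball_subset_dyadic_ball:
  assumes "0 < p" "0 < M" "0 \<le> smooth_index \<alpha> p"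
  shows "Lp_ball p \<alpha> M \<subseteq> dyadic_ball p (smooth_index \<alpha> p) M"
proof
  fix \<theta> assume \<theta>: "\<theta> \<in> Lp_ball p \<alpha> M"
  define s where "s = smooth_index \<alpha> p"
  define a where "a i = real i powr (p * s) * \<bar>\<theta> i\<bar> powr p" for i
  have sm: "summable (\<lambda>i. a (Suc i))" and le: "(\<Sum>i. a (Suc i)) powr (1/p) \<le> M"
    using \<theta> by (auto simp: Lp_ball_def s_def a_def)
  have "(\<Sum>k<2 ^ j. \<bar>\<theta> (2 ^ j + k)\<bar> powr p) \<le> M powr p * 2 powr (- real j * (p * s))" for j
  proof -
    let ?S = "\<Sum>k<2 ^ j. \<bar>\<theta> (2 ^ j + k)\<bar> powr p"
    have "2 powr (real j * (p * s)) * ?S = (\<Sum>k<2 ^ j. 2 powr (real j * (p * s)) * \<bar>\<theta> (2 ^ j + k)\<bar> powr p)"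
      by (rule sum_distrib_left)
    also have "\<dots> \<le> (\<Sum>k<2 ^ j. a (2 ^ j + k))"
      unfolding a_def
    proof (intro sum_mono mult_right_mono)
      fix k :: nat
      have "2 powr (real j * (p * s)) = (2 ^ j) powr (p * s)"
        by (simp add: powr_realpow[symmetric] powr_powr)
      also have "\<dots> \<le> real (2 ^ j + k) powr (p * s)"
        using assms by (intro powr_mono2) (auto simp: s_def)
      finally show "2 powr (real j * (p * s)) \<le> real (2 ^ j + k) powr (p * s)" .
    qed auto
    also have "\<dots> = sum a {2 ^ j..<2 ^ Suc j}" by (rule sum_dyadic_level[symmetric])
    also have "\<dots> = (\<Sum>i\<in>{2 ^ j - 1..<2 ^ Suc j - 1}. a (Suc i))"
      by (rule sum.reindex_bij_witness[of _ Suc "\<lambda>i. i - 1"])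
         (auto simp: less_diff_conv intro: diff_less_mono dest: order_less_le_trans)
    also have "\<dots> \<le> (\<Sum>i. a (Suc i))"
      by (rule sum_le_suminf[OF sm]) (auto simp: a_def)
    also have "\<dots> \<le> M powr p"
      using le assms by (subst (asm) powr_inverse_le_iff) (auto intro!: suminf_nonneg[OF sm], simp add: a_def)
    finally show ?thesis by (simp add: powr_minus field_simps)
  qed
  then show "\<theta> \<in> dyadic_ball p (smooth_index \<alpha> p) M"
    by (simp add: dyadic_ball_def s_def)
qed

text \<open>Each coefficient of the block is at most \<open>B\<close>, so its square is at most
  \<open>B powr (2 - p)\<close> times its \<open>p\<close>-th power.\<close>

lemma dyadic_ball_energy_level:
  assumes "0 < p" "p \<le> 2" "0 < M" and \<theta>: "\<theta> \<in> dyadic_ball p s M"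
  shows "(\<Sum>k<2 ^ j. (\<theta> (2 ^ j + k))\<^sup>2) \<le> M\<^sup>2 * 2 powr (- real j * (2 * s))"
proof -
  define B where "B = M * 2 powr (- real j * s)"
  have B: "0 < B" using assms by (simp add: B_def)
  have Bp: "B powr p = M powr p * 2 powr (- real j * (p * s))"
    using assms by (simp add: B_def powr_mult powr_powr mult_ac)
  let ?S = "\<Sum>k<2 ^ j. \<bar>\<theta> (2 ^ j + k)\<bar> powr p"
  have S: "?S \<le> B powr p" using \<theta> by (simp add: dyadic_ball_def Bp)
  have "(\<theta> (2 ^ j + k))\<^sup>2 \<le> B powr (2 - p) * \<bar>\<theta> (2 ^ j + k)\<bar> powr p" if "k < 2 ^ j" for k
  proof -
    let ?x = "\<bar>\<theta> (2 ^ j + k)\<bar>"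
    have "?x powr p \<le> ?S" using that by (intro member_le_sum) auto
    then have "?x powr p \<le> B powr p" using S by linarith
    then have "?x \<le> B" using assms B powr_less_mono2[of p B ?x] by force
    then have "?x powr (2 - p) \<le> B powr (2 - p)" using assms by (intro powr_mono2) auto
    then have "?x powr (2 - p) * ?x powr p \<le> B powr (2 - p) * ?x powr p" by (intro mult_right_mono) auto
    then show ?thesis by (simp add: powr_add[symmetric])
  qed
  then have "(\<Sum>k<2 ^ j. (\<theta> (2 ^ j + k))\<^sup>2) \<le> (\<Sum>k<2 ^ j. B powr (2 - p) * \<bar>\<theta> (2 ^ j + k)\<bar> powr p)"
    by (intro sum_mono) auto
  also have "\<dots> = B powr (2 - p) * ?S" by (rule sum_distrib_left[symmetric])
  also have "\<dots> \<le> B powr (2 - p) * B powr p" by (intro mult_left_mono S) auto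
  also have "\<dots> = B\<^sup>2" using B by (simp add: powr_add[symmetric])
  also have "\<dots> = M\<^sup>2 * (2 powr (- real j * s)) powr 2" by (simp add: B_def power_mult_distrib)
  also have "\<dots> = M\<^sup>2 * 2 powr (- real j * (2 * s))" by (simp only: powr_powr mult_ac)
  finally show ?thesis .
qed

lemma dyadic_ball_energy:
  assumes "0 < p" "p \<le> 2" "0 < M" "0 < s"
  obtains K where "0 < K"
    "\<And>\<theta> m N. \<theta> \<in> dyadic_ball p s M \<Longrightarrow> 1 \<le> m \<Longrightarrow> (\<Sum>i = m..N. (\<theta> i)\<^sup>2) \<le> K * real m powr (- 2 * s)"
proof
  let ?K = "2 powr (2 * s) / (1 - 2 powr (- (2 * s))) * M\<^sup>2"
  have "2 powr (- (2 * s)) < 1" using assms by (intro powr_less_one) auto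
  then show "0 < ?K" using assms by simp
  show "(\<Sum>i = m..N. (\<theta> i)\<^sup>2) \<le> ?K * real m powr (- 2 * s)"
    if "\<theta> \<in> dyadic_ball p s M" "1 \<le> m" for \<theta> m N
    using sum_le_dyadic[OF _ _ _ dyadic_ball_energy_level[OF assms(1-3) that(1)] that(2), of N] assms by simp
qed

text \<open>Half of the decay exponent \<open>p * s\<close> pays for the weight, which later absorbs
  the logarithmic growth of the thresholds; the other half makes the blocks summable.\<close>

lemma dyadic_ball_weighted:
  assumes "0 < p" "0 < M" "0 < s"
  obtains K where "0 < K"
    "\<And>\<theta> m N. \<theta> \<in> dyadic_ball p s M \<Longrightarrow> 1 \<le> m \<Longrightarrow>
      (\<Sum>i = m..N. real i powr (p * s / 2) * \<bar>\<theta> i\<bar> powr p) \<le> K * real m powr (- p * s / 2)"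
proof
  define \<beta> where "\<beta> = p * s / 2"
  have \<beta>: "0 < \<beta>" using assms by (simp add: \<beta>_def)
  let ?K = "2 powr \<beta> / (1 - 2 powr (- \<beta>)) * (2 powr \<beta> * M powr p)"
  have "2 powr (- \<beta>) < 1" using \<beta> by (intro powr_less_one) auto
  then show "0 < ?K" using assms by simp
  fix \<theta> m N assume \<theta>: "\<theta> \<in> dyadic_ball p s M" and m: "1 \<le> (m::nat)"
  have "(\<Sum>k<2 ^ j. real (2 ^ j + k) powr \<beta> * \<bar>\<theta> (2 ^ j + k)\<bar> powr p)
      \<le> (2 powr \<beta> * M powr p) * 2 powr (- real j * \<beta>)" for j
  proof -
    have "(\<Sum>k<2 ^ j. real (2 ^ j + k) powr \<beta> * \<bar>\<theta> (2 ^ j + k)\<bar> powr p)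
      \<le> (\<Sum>k<2 ^ j. 2 powr (real (Suc j) * \<beta>) * \<bar>\<theta> (2 ^ j + k)\<bar> powr p)"
    proof (intro sum_mono mult_right_mono)
      fix k :: nat assume "k \<in> {..<2 ^ j}"
      then have "2 ^ j + k \<le> 2 ^ Suc j" by simp
      then have "real (2 ^ j + k) \<le> 2 ^ Suc j" by (metis of_nat_le_iff of_nat_numeral of_nat_power)
      then have "real (2 ^ j + k) powr \<beta> \<le> (2 ^ Suc j) powr \<beta>"
        using \<beta> by (intro powr_mono2) auto
      also have "\<dots> = (2 powr real (Suc j)) powr \<beta>" by (subst powr_realpow) auto
      finally show "real (2 ^ j + k) powr \<beta> \<le> 2 powr (real (Suc j) * \<beta>)"
        by (simp only: powr_powr)
    qed auto
    also have "\<dots> = 2 powr (real (Suc j) * \<beta>) * (\<Sum>k<2 ^ j. \<bar>\<theta> (2 ^ j + k)\<bar> powr p)"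
      by (rule sum_distrib_left[symmetric])
    also have "\<dots> \<le> 2 powr (real (Suc j) * \<beta>) * (M powr p * 2 powr (- real j * (2 * \<beta>)))"
      using \<theta> by (intro mult_left_mono) (auto simp: dyadic_ball_def \<beta>_def)
    also have "\<dots> = M powr p * 2 powr (real (Suc j) * \<beta> + (- real j * (2 * \<beta>)))"
      by (simp only: powr_add mult_ac)
    also have "real (Suc j) * \<beta> + (- real j * (2 * \<beta>)) = \<beta> + - real j * \<beta>"
      by (simp add: algebra_simps)
    finally show ?thesis by (simp only: powr_add mult_ac)
  qed
  from sum_le_dyadic[OF _ _ \<beta> this m, of N]
  have "(\<Sum>i = m..N. real i powr \<beta> * \<bar>\<theta> i\<bar> powr p) \<le> ?K * real m powr (- \<beta>)" by simp
  then show "(\<Sum>i = m..N. real i powr (p * s / 2) * \<bar>\<theta> i\<bar> powr p) \<le> ?K * real m powr (- p * s / 2)"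
    by (simp add: \<beta>_def)
qed

text \<open>Condensation: block \<open>j\<close> has \<open>2 ^ j\<close> terms, each at most
  \<open>(2 ^ j) powr (- e)\<close>.\<close>

lemma sum_powr_tail_le:
  assumes "1 < e"
  obtains K where "0 < K" "\<And>m N. 1 \<le> m \<Longrightarrow> (\<Sum>i = m..N. real i powr (- e)) \<le> K * real m powr (1 - e)"
proof
  let ?K = "2 powr (e - 1) / (1 - 2 powr (- (e - 1)))"
  have "2 powr (- (e - 1)) < 1" using assms by (intro powr_less_one) auto
  then show "0 < ?K" by simp
  fix m N :: nat assume m: "1 \<le> m"
  have "(\<Sum>k<2 ^ j. real (2 ^ j + k) powr (- e)) \<le> 1 * 2 powr (- real j * (e - 1))" for j
  proof -
    have "(\<Sum>k<2 ^ j. real (2 ^ j + k) powr (- e)) \<le> (\<Sum>k<(2::nat) ^ j. (2 ^ j) powr (- e))"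
      using assms by (intro sum_mono powr_mono2') auto
    also have "\<dots> = (2 powr real j) * (2 powr real j) powr (- e)"
      by (simp add: powr_realpow)
    also have "\<dots> = 2 powr (real j + real j * - e)" by (simp only: powr_add powr_powr)
    finally show ?thesis by (simp add: algebra_simps)
  qed
  from sum_le_dyadic[OF _ _ _ this m, of N] assms
  show "(\<Sum>i = m..N. real i powr (- e)) \<le> ?K * real m powr (1 - e)" by simp
qed

section \<open>The risk of the quadratic functional estimator\<close>

lemma gauss_noise_transfer:
  fixes f :: "real \<Rightarrow> real"
  assumes P: "gauss_noise P z" and [measurable]: "f \<in> borel_measurable borel"
  shows "integrable P (\<lambda>\<omega>. f (z i \<omega>)) \<longleftrightarrow> integrable std_gauss f"
    and "(\<integral>\<omega>. f (z i \<omega>) \<partial>P) = (\<integral>x. f x \<partial>std_gauss)"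
proof -
  have D: "distr P lborel (z i) = std_gauss" and [measurable]: "z i \<in> borel_measurable P"
    using P by (auto simp: gauss_noise_def distributed_def)
  show "integrable P (\<lambda>\<omega>. f (z i \<omega>)) \<longleftrightarrow> integrable std_gauss f"
    unfolding D[symmetric] by (subst integrable_distr_eq) auto
  show "(\<integral>\<omega>. f (z i \<omega>) \<partial>P) = (\<integral>x. f x \<partial>std_gauss)"
    unfolding D[symmetric] by (subst integral_distr) auto
qed

text \<open>In the application \<open>c\<close> is the sample size and \<open>d\<close> is the
  target \<open>Qfun \<theta>\<close>. Composition with the fixed functions \<open>W i\<close>
  preserves independence, so the variance and bias split applies.\<close>

lemma soft_sq_sum_risk:
  fixes A :: "nat set" and \<tau> t :: "nat \<Rightarrow> real" and c d :: real
  assumes P: "gauss_noise P z" and "finite A" and \<tau>: "\<And>i. i \<in> A \<Longrightarrow> 0 \<le> \<tau> i"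
  defines "W \<equiv> \<lambda>i x. (soft_sq (\<tau> i) (x + t i) - (\<integral>y. soft_sq (\<tau> i) y \<partial>std_gauss)) / c"
  shows "(\<integral>\<^sup>+ \<omega>. ennreal (((\<Sum>i\<in>A. W i (z i \<omega>)) - d)\<^sup>2) \<partial>P)
    \<le> ennreal ((\<Sum>i\<in>A. 56 * exp (- 2 * \<tau> i / 5) + 10 * (t i)\<^sup>2) / c\<^sup>2
        + ((\<Sum>i\<in>A. soft_gain (\<tau> i) (t i) / c) - d)\<^sup>2)"
proof -
  interpret P: prob_space P using P by (simp add: gauss_noise_def)
  have Wm [measurable]: "W i \<in> borel_measurable borel" for i
    unfolding W_def by measurable
  have ind: "P.indep_vars (\<lambda>_. borel) (\<lambda>i \<omega>. W i (z i \<omega>)) A"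
    using P by (intro P.indep_vars_compose2[OF P.indep_vars_subset[of "\<lambda>_. borel" z UNIV A]])
      (auto simp: gauss_noise_def)
  have I: "integrable std_gauss (W i)" "integrable std_gauss (\<lambda>x. (W i x)\<^sup>2)" 
    and E: "(\<integral>x. W i x \<partial>std_gauss) = soft_gain (\<tau> i) (t i) / c"
    and V: "std_gauss.variance (W i) \<le> (56 * exp (- 2 * \<tau> i / 5) + 10 * (t i)\<^sup>2) / c\<^sup>2"
    if "i \<in> A" for i
  proof -
    let ?f = "\<lambda>x. soft_sq (\<tau> i) (x + t i)" and ?e = "\<integral>y. soft_sq (\<tau> i) y \<partial>std_gauss"
    note J = integrable_soft_sq_shift[OF \<tau>[OF that], of "t i"]
      integrable_soft_sq_shift_square[OF \<tau>[OF that], of "t i"]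
    show "integrable std_gauss (W i)" unfolding W_def using J by auto
    have "(W i x)\<^sup>2 = ((?f x)\<^sup>2 - 2 * ?e * ?f x + ?e\<^sup>2) / c\<^sup>2" for x
      unfolding W_def by (simp add: power_divide power2_diff mult_ac)
    then show "integrable std_gauss (\<lambda>x. (W i x)\<^sup>2)" using J by simp
    show EW: "(\<integral>x. W i x \<partial>std_gauss) = soft_gain (\<tau> i) (t i) / c"
      unfolding W_def soft_gain_def using J by simp
    have "W i x - (\<integral>x. W i x \<partial>std_gauss) = (?f x - (\<integral>x. ?f x \<partial>std_gauss)) / c" for x
      unfolding EW by (simp add: W_def soft_gain_def diff_divide_distrib)
    then have "std_gauss.variance (W i) = std_gauss.variance ?f / c\<^sup>2"
      by (simp add: power_divide)
    also have "\<dots> \<le> (56 * exp (- 2 * \<tau> i / 5) + 10 * (t i)\<^sup>2) / c\<^sup>2"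
      by (intro divide_right_mono soft_sq_variance \<tau> that) auto
    finally show "std_gauss.variance (W i) \<le> (56 * exp (- 2 * \<tau> i / 5) + 10 * (t i)\<^sup>2) / c\<^sup>2" .
  qed
  have "has_bochner_integral P (\<lambda>\<omega>. ((\<Sum>i\<in>A. W i (z i \<omega>)) - d)\<^sup>2)
    ((\<Sum>i\<in>A. P.variance (\<lambda>\<omega>. W i (z i \<omega>))) + ((\<Sum>i\<in>A. P.expectation (\<lambda>\<omega>. W i (z i \<omega>))) - d)\<^sup>2)"
    using gauss_noise_transfer(1)[OF P, of "W i" i for i]
      gauss_noise_transfer(1)[OF P, of "\<lambda>x. (W i x)\<^sup>2" i for i] I
    by (intro P.indep_vars_mean_square_error[OF ind \<open>finite A\<close>]) auto
  moreover have "(\<Sum>i\<in>A. P.expectation (\<lambda>\<omega>. W i (z i \<omega>))) = (\<Sum>i\<in>A. soft_gain (\<tau> i) (t i) / c)"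
    by (intro sum.cong refl) (simp add: gauss_noise_transfer(2)[OF P] E)
  moreover have "(\<Sum>i\<in>A. P.variance (\<lambda>\<omega>. W i (z i \<omega>)))
      \<le> (\<Sum>i\<in>A. (56 * exp (- 2 * \<tau> i / 5) + 10 * (t i)\<^sup>2) / c\<^sup>2)"
  proof (intro sum_mono)
    fix i assume i: "i \<in> A"
    have "P.variance (\<lambda>\<omega>. W i (z i \<omega>)) = std_gauss.variance (W i)"
      by (simp add: gauss_noise_transfer(2)[OF P, of "W i"]
          gauss_noise_transfer(2)[OF P, of "\<lambda>x. (W i x - _)\<^sup>2"])
    then show "P.variance (\<lambda>\<omega>. W i (z i \<omega>)) \<le> (56 * exp (- 2 * \<tau> i / 5) + 10 * (t i)\<^sup>2) / c\<^sup>2"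
      using V[OF i] by simp
  qed
  ultimately show ?thesis
    by (auto simp: has_bochner_integral_iff nn_integral_eq_integral sum_divide_distrib intro!: ennreal_leI)
qed

section \<open>The estimator as a single sum and its risk bound\<close>

definition threshold :: "real \<Rightarrow> real \<Rightarrow> nat \<Rightarrow> nat \<Rightarrow> real" where
  "threshold p s n i = (if i \<le> m3 p s n then 0 else tau p s n i)"

lemma threshold_bounds:
  assumes "1 \<le> m3 p s n" "m3 p s n < i"
  shows "2 * log 2 (real i / real (m3 p s n)) \<le> threshold p s n i"
    and "threshold p s n i \<le> 2 * log 2 (real i / real (m3 p s n)) + 2"
    and "0 \<le> threshold p s n i"
proof -
  let ?l = "log 2 (real i / real (m3 p s n))"
  have "0 \<le> ?l" using assms by (intro zero_le_log_cancel_iff[THEN iffD2]) auto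
  then show "2 * ?l \<le> threshold p s n i" "threshold p s n i \<le> 2 * ?l + 2" "0 \<le> threshold p s n i"
    using assms(2) by (auto simp: threshold_def tau_def, linarith+)
qed

lemma threshold_nonneg: "1 \<le> m3 p s n \<Longrightarrow> 0 \<le> threshold p s n i"
  using threshold_bounds(3)[of p s n i] by (cases "m3 p s n < i") (auto simp: threshold_def)

text \<open>With \<open>\<tau> = 0\<close> the centred terms \<open>Y\<^sub>i\<^sup>2 - 1/n\<close> of the first sum have the same shape
  as the thresholded ones.\<close>
lemma Qhat3_eq:
  assumes "0 < n"
  shows "Qhat3 p s n (\<lambda>i. \<theta> i + x i / sqrt (real n)) =
    (\<Sum>i = 1..2 ^ Jstar p s n * m3 p s n.
      (soft_sq (threshold p s n i) (x i + \<theta> i * sqrt (real n))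
        - (\<integral>y. soft_sq (threshold p s n i) y \<partial>std_gauss)) / real n)"
proof -
  let ?m = "m3 p s n" and ?N = "2 ^ Jstar p s n * m3 p s n"
  let ?W = "\<lambda>i. (soft_sq (threshold p s n i) (x i + \<theta> i * sqrt (real n))
        - (\<integral>y. soft_sq (threshold p s n i) y \<partial>std_gauss)) / real n"
  have sq: "(\<theta> i + x i / sqrt (real n))\<^sup>2 = (x i + \<theta> i * sqrt (real n))\<^sup>2 / real n" for i
  proof -
    have "\<theta> i + x i / sqrt (real n) = (x i + \<theta> i * sqrt (real n)) / sqrt (real n)"
      using assms by (simp add: field_simps)
    then show ?thesis by (simp add: power_divide)
  qed
  have scale: "max 0 (a / real n - b / real n) = soft_sq b u / real n" if "a = u\<^sup>2" for a b u
    using assms that by (simp add: soft_sq_def max_def field_simps)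
  have 1: "(\<theta> i + x i / sqrt (real n))\<^sup>2 - 1 / real n = ?W i" if "i \<le> ?m" for i
  proof -
    have "soft_sq 0 = (\<lambda>y. y\<^sup>2)" by (auto simp: soft_sq_def)
    then show ?thesis
      using that by (simp add: sq threshold_def std_gauss_moments diff_divide_distrib)
  qed
  have mu: "mu p s n i = (\<integral>y. soft_sq (tau p s n i) y \<partial>std_gauss) / real n" for i
  proof -
    have "mu p s n i = (\<integral>y. soft_sq (tau p s n i) y / real n \<partial>std_gauss)"
      unfolding mu_def by (simp add: power_divide scale)
    then show ?thesis by simp
  qed
  have 2: "max 0 ((\<theta> i + x i / sqrt (real n))\<^sup>2 - tau p s n i / real n) - mu p s n i = ?W i" if "?m < i" for i
    using that by (simp add: sq scale mu threshold_def diff_divide_distrib)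
  have "Qhat3 p s n (\<lambda>i. \<theta> i + x i / sqrt (real n)) = (\<Sum>i = 1..?m. ?W i) + (\<Sum>i = ?m + 1..?N. ?W i)"
    unfolding Qhat3_def by (intro arg_cong2[of _ _ _ _ "(+)"] sum.cong refl 1 2) auto
  also have "\<dots> = (\<Sum>i = 1..?N. ?W i)"
    using sum.ub_add_nat[of 1 ?m ?W "?N - ?m"] by simp
  finally show ?thesis .
qed

text \<open>The uniform bound on finite tail sums does two things: it makes the series defining
  \<open>Qfun\<close> summable, and it bounds the remainder.\<close>

lemma Qfun_split:
  assumes bound: "\<And>N. (\<Sum>i = m + 1..N. (\<theta> i)\<^sup>2) \<le> B"
  shows "\<bar>Qfun \<theta> - (\<Sum>i = 1..m. (\<theta> i)\<^sup>2)\<bar> \<le> B"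
proof -
  let ?f = "\<lambda>i. (\<theta> (Suc i))\<^sup>2"
  have part: "(\<Sum>i<N. ?f (i + m)) \<le> B" for N
  proof -
    have "(\<Sum>i<N. ?f (i + m)) = (\<Sum>i = m + 1..m + N. (\<theta> i)\<^sup>2)"
      by (rule sum.reindex_bij_witness[of _ "\<lambda>i. i - Suc m" "\<lambda>i. Suc (i + m)"]) auto
    then show ?thesis using bound by simp
  qed
  have sm: "summable (\<lambda>i. ?f (i + m))"
    by (rule bounded_imp_summable[of _ B]) (use part[of "Suc _"] in \<open>auto simp: lessThan_Suc_atMost\<close>)
  then have "summable ?f" by (subst (asm) summable_iff_shift)
  then have "Qfun \<theta> = (\<Sum>i. ?f (i + m)) + (\<Sum>i<m. ?f i)"
    unfolding Qfun_def by (rule suminf_split_initial_segment)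
  moreover have "(\<Sum>i<m. ?f i) = (\<Sum>i = 1..m. (\<theta> i)\<^sup>2)"
    by (rule sum.reindex_bij_witness[of _ "\<lambda>i. i - 1" Suc]) auto
  moreover have "0 \<le> (\<Sum>i. ?f (i + m))" by (intro suminf_nonneg sm) auto
  moreover have "(\<Sum>i. ?f (i + m)) \<le> B" using part by (intro suminf_le_const sm)
  ultimately show ?thesis by simp
qed

text \<open>The four terms are the pure noise variance, the variance due to the signal, the squared
  thresholding bias and the squared truncation bias; the factors 2 come from separating the two
  biases.\<close>

lemma risk3_le:
  assumes P: "gauss_noise P z" and n: "0 < n" and m: "1 \<le> m3 p s n"
    and N: "N = 2 ^ Jstar p s n * m3 p s n"
    and tail: "\<And>N'. (\<Sum>i = N + 1..N'. (\<theta> i)\<^sup>2) \<le> B"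
  shows "risk3 P z p s n \<theta> \<le> ennreal
    (56 * (\<Sum>i = 1..N. exp (- 2 * threshold p s n i / 5)) / (real n)\<^sup>2
      + 10 * (\<Sum>i = 1..N. (\<theta> i)\<^sup>2) / real n
      + 2 * (\<Sum>i = 1..N. min (4 * (\<theta> i)\<^sup>2) (threshold p s n i / real n))\<^sup>2
      + 2 * B\<^sup>2)"
proof -
  let ?\<tau> = "threshold p s n" and ?t = "\<lambda>i. \<theta> i * sqrt (real n)"
  have t2: "(?t i)\<^sup>2 = real n * (\<theta> i)\<^sup>2" for i by (simp add: power_mult_distrib)
  let ?S = "\<Sum>i = 1..N. min (4 * (\<theta> i)\<^sup>2) (?\<tau> i / real n)"
  have "risk3 P z p s n \<theta> \<le> ennreal ((\<Sum>i = 1..N. 56 * exp (- 2 * ?\<tau> i / 5) + 10 * (?t i)\<^sup>2) / (real n)\<^sup>2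
        + ((\<Sum>i = 1..N. soft_gain (?\<tau> i) (?t i) / real n) - Qfun \<theta>)\<^sup>2)"
    unfolding risk3_def Qhat3_eq[OF n] N
    by (rule soft_sq_sum_risk[OF P]) (auto intro: threshold_nonneg m)
  also have "\<dots> \<le> ennreal (56 * (\<Sum>i = 1..N. exp (- 2 * ?\<tau> i / 5)) / (real n)\<^sup>2
      + 10 * (\<Sum>i = 1..N. (\<theta> i)\<^sup>2) / real n + (2 * ?S\<^sup>2 + 2 * B\<^sup>2))"
  proof (intro ennreal_leI add_mono)
    show "(\<Sum>i = 1..N. 56 * exp (- 2 * ?\<tau> i / 5) + 10 * (?t i)\<^sup>2) / (real n)\<^sup>2
      \<le> 56 * (\<Sum>i = 1..N. exp (- 2 * ?\<tau> i / 5)) / (real n)\<^sup>2 + 10 * (\<Sum>i = 1..N. (\<theta> i)\<^sup>2) / real n"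
    proof -
      have "(\<Sum>i = 1..N. 56 * exp (- 2 * ?\<tau> i / 5) + 10 * (?t i)\<^sup>2)
        = 56 * (\<Sum>i = 1..N. exp (- 2 * ?\<tau> i / 5)) + 10 * (real n * (\<Sum>i = 1..N. (\<theta> i)\<^sup>2))"
        by (simp only: t2 sum.distrib sum_distrib_left)
      then show ?thesis using n by (simp add: add_divide_distrib power2_eq_square)
    qed
    let ?d = "\<Sum>i = 1..N. soft_gain (?\<tau> i) (?t i) / real n - (\<theta> i)\<^sup>2"
    let ?r = "Qfun \<theta> - (\<Sum>i = 1..N. (\<theta> i)\<^sup>2)"
    have "\<bar>soft_gain (?\<tau> i) (?t i) / real n - (\<theta> i)\<^sup>2\<bar> \<le> min (4 * (\<theta> i)\<^sup>2) (?\<tau> i / real n)" for i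
    proof -
      have "\<bar>soft_gain (?\<tau> i) (?t i) / real n - (\<theta> i)\<^sup>2\<bar> = \<bar>soft_gain (?\<tau> i) (?t i) - (?t i)\<^sup>2\<bar> / real n"
        using n by (subst abs_div_pos) (auto simp: t2 diff_divide_distrib)
      also have "\<dots> \<le> min (4 * (?t i)\<^sup>2) (?\<tau> i) / real n"
        by (intro divide_right_mono soft_gain_bias threshold_nonneg m) auto
      finally show ?thesis using n by (simp add: t2 min_def field_simps split: if_splits)
    qed
    then have d: "\<bar>?d\<bar> \<le> ?S" by (intro order_trans[OF sum_abs] sum_mono)
    have r: "\<bar>?r\<bar> \<le> B" by (rule Qfun_split[OF tail])
    have "((\<Sum>i = 1..N. soft_gain (?\<tau> i) (?t i) / real n) - Qfun \<theta>)\<^sup>2 = (?d - ?r)\<^sup>2"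
      by (simp add: sum_subtractf)
    also have "\<dots> \<le> 2 * ?d\<^sup>2 + 2 * ?r\<^sup>2"
    proof -
      have "(a - b)\<^sup>2 \<le> 2 * a\<^sup>2 + 2 * b\<^sup>2" for a b :: real
        using zero_le_power2[of "a + b"] by (simp add: power2_sum power2_diff)
      then show ?thesis .
    qed
    also have "\<dots> \<le> 2 * ?S\<^sup>2 + 2 * B\<^sup>2"
      using power_mono[OF d abs_ge_zero, of 2] power_mono[OF r abs_ge_zero, of 2] 
      unfolding power2_abs by linarith
    finally show "((\<Sum>i = 1..N. soft_gain (?\<tau> i) (?t i) / real n) - Qfun \<theta>)\<^sup>2 \<le> 2 * ?S\<^sup>2 + 2 * B\<^sup>2" .
  qed
  finally show ?thesis by (simp only: add.assoc)
qed

text \<open>Only an inequality, since the right side overshoots when \<open>N < m\<close>.\<close>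

lemma sum_split_le:
  fixes f :: "nat \<Rightarrow> real"
  assumes "\<And>i. 0 \<le> f i"
  shows "sum f {1..N} \<le> sum f {1..m} + sum f {m + 1..N}"
proof -
  have "sum f {1..N} \<le> sum f ({1..m} \<union> {m + 1..N})"
    by (rule sum_mono2) (use assms in auto)
  also have "\<dots> = sum f {1..m} + sum f {m + 1..N}" by (rule sum.union_disjoint) auto
  finally show ?thesis .
qed

text \<open>The exponent \<open>2/5\<close> is large enough for this sum to converge: since \<open>\<tau>\<^sub>i \<ge> 2 log\<^sub>2 (i / m)\<close>,
  the summands are at most \<open>(i / m) powr (- e)\<close> with \<open>e = 4 / (5 ln 2) > 1\<close>.\<close>
lemma threshold_exp_sum:
  obtains K where "0 < K" "\<And>p s n N. 1 \<le> m3 p s n \<Longrightarrow>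
    (\<Sum>i = 1..N. exp (- 2 * threshold p s n i / 5)) \<le> K * real (m3 p s n)"
proof -
  define e where "e = 4 / (5 * ln (2::real))"
  \<comment> \<open>This amounts to \<open>ln 2 < 4 / 5\<close>.\<close>
  have e: "1 < e" using ln2_le_25_over_36 by (simp add: e_def field_simps)
  obtain K where K: "0 < K" "\<And>m N. 1 \<le> m \<Longrightarrow> (\<Sum>i = m..N. real i powr (- e)) \<le> K * real m powr (1 - e)"
    by (fact sum_powr_tail_le[OF e])
  have "(\<Sum>i = 1..N. exp (- 2 * threshold p s n i / 5)) \<le> (1 + K) * real (m3 p s n)"
    if m1: "1 \<le> m3 p s n" for p s n N
  proof -
    let ?m = "m3 p s n"
    have "exp (- 2 * threshold p s n i / 5) \<le> real ?m powr e * real i powr (- e)" if "?m < i" for i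
    proof -
      have "- 2 * threshold p s n i / 5 \<le> - 2 * (2 * log 2 (real i / real ?m)) / 5"
        using threshold_bounds(1)[OF m1 that] by simp
      also have "\<dots> = - e * ln (real i / real ?m)"
        by (simp add: e_def log_def)
      finally have "exp (- 2 * threshold p s n i / 5) \<le> exp (- e * ln (real i / real ?m))" by simp
      also have "\<dots> = (real i / real ?m) powr (- e)"
        using m1 that by (simp add: powr_def)
      also have "\<dots> = real ?m powr e * real i powr (- e)"
        using m1 that by (simp add: powr_divide powr_minus field_simps)
      finally show ?thesis .
    qed
    then have "(\<Sum>i = ?m + 1..N. exp (- 2 * threshold p s n i / 5))
        \<le> (\<Sum>i = ?m + 1..N. real ?m powr e * real i powr (- e))"
      by (intro sum_mono) auto
    also have "\<dots> = real ?m powr e * (\<Sum>i = ?m + 1..N. real i powr (- e))"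
      by (rule sum_distrib_left[symmetric])
    also have "\<dots> \<le> real ?m powr e * (K * real (?m + 1) powr (1 - e))"
      by (intro mult_left_mono K) auto
    also have "\<dots> \<le> real ?m powr e * (K * real ?m powr (1 - e))"
      using K(1) e m1 by (intro mult_left_mono powr_mono2') auto
    also have "\<dots> = K * real ?m"
      using m1 by (simp add: mult.left_commute powr_add[symmetric])
    finally have "(\<Sum>i = ?m + 1..N. exp (- 2 * threshold p s n i / 5)) \<le> K * real ?m" .
    moreover have "(\<Sum>i = 1..?m. exp (- 2 * threshold p s n i / 5)) = real ?m"
      by (simp add: threshold_def)
    moreover have "(\<Sum>i = 1..N. exp (- 2 * threshold p s n i / 5)) \<le> (\<Sum>i = 1..?m. exp (- 2 * threshold p s n i / 5))
       + (\<Sum>i = ?m + 1..N. exp (- 2 * threshold p s n i / 5))"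
      by (rule sum_split_le) auto
    ultimately show ?thesis by (simp add: algebra_simps)
  qed
  then show ?thesis using K(1) by (intro that[of "1 + K"]) auto
qed

text \<open>The minimum is the product of its own powers with exponents \<open>u\<close> and
  \<open>1 - u\<close>; each factor is then enlarged separately.\<close>

lemma min_le_powr_interpolate:
  fixes a b u :: real
  assumes "0 \<le> a" "0 \<le> b" "0 \<le> u" "u \<le> 1"
  shows "min a b \<le> a powr u * b powr (1 - u)"
proof (cases "min a b = 0")
  case False
  then have "0 < min a b" using assms by auto
  then have "min a b = min a b powr u * min a b powr (1 - u)"
    by (simp add: powr_add[symmetric])
  also have "\<dots> \<le> a powr u * b powr (1 - u)"
    using assms by (intro mult_mono powr_mono2) auto
  finally show ?thesis .
qed (use assms in auto)

text \<open>Interpolation with exponent \<open>p / 2\<close> turns each minimum into the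
  \<open>p\<close>-th power of the coefficient times a power of \<open>threshold / n\<close>. The
  logarithm in the threshold is traded for a small power of \<open>i / m\<close>, and
  \<open>dyadic_ball_weighted\<close> sums the result.\<close>

lemma threshold_bias_sum:
  assumes "0 < p" "p < 2" "0 < M" "0 < s"
  obtains K where "0 < K" "\<And>n N \<theta>. 0 < n \<Longrightarrow> 1 \<le> m3 p s n \<Longrightarrow> \<theta> \<in> dyadic_ball p s M \<Longrightarrow>
    (\<Sum>i = 1..N. min (4 * (\<theta> i)\<^sup>2) (threshold p s n i / real n))
      \<le> K * real n powr (p / 2 - 1) * real (m3 p s n) powr (- p * s)"
proof -
  define \<beta> where "\<beta> = p * s / 2"
  define u where "u = p / 2"
  \<comment> \<open>Chosen so that \<open>\<delta> * (1 - u) = \<beta>\<close>: after interpolation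
    the power of \<open>i / m\<close> is exactly the available weight.\<close>
  define \<delta> where "\<delta> = \<beta> / (1 - u)"
  \<comment> \<open>With \<open>x = i / m\<close> this gives
    \<open>2 * log 2 x + 2 \<le> L * x powr \<delta>\<close>; the first summand bounds the
    logarithm, the second the rounding of the ceiling.\<close>
  define L where "L = 2 / (\<delta> * ln 2) + 2"
  have pos: "0 < \<beta>" "0 < u" "u < 1" "0 < \<delta>" using assms by (auto simp: \<beta>_def u_def \<delta>_def)
  have L: "0 < L" using pos by (simp add: L_def add_pos_pos)
  obtain K where "0 < K" and K': "\<And>\<theta> m N. \<theta> \<in> dyadic_ball p s M \<Longrightarrow> 1 \<le> m \<Longrightarrow>
      (\<Sum>i = m..N. real i powr (p * s / 2) * \<bar>\<theta> i\<bar> powr p) \<le> K * real m powr (- p * s / 2)"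
    by (fact dyadic_ball_weighted[OF assms(1,3,4)])
  have K: "0 < K" "\<And>\<theta> m N. \<theta> \<in> dyadic_ball p s M \<Longrightarrow> 1 \<le> m \<Longrightarrow>
      (\<Sum>i = m..N. real i powr \<beta> * \<bar>\<theta> i\<bar> powr p) \<le> K * real m powr (- \<beta>)"
    using \<open>0 < K\<close> K' by (simp_all add: \<beta>_def)
  let ?C = "4 powr u * L powr (1 - u) * K"
  have "(\<Sum>i = 1..N. min (4 * (\<theta> i)\<^sup>2) (threshold p s n i / real n))
      \<le> ?C * real n powr (p / 2 - 1) * real (m3 p s n) powr (- p * s)"
    if n: "0 < n" and m1: "1 \<le> m3 p s n" and \<theta>: "\<theta> \<in> dyadic_ball p s M" for n N \<theta>
  proof -
    let ?m = "m3 p s n" and ?f = "\<lambda>i. min (4 * (\<theta> i)\<^sup>2) (threshold p s n i / real n)"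
    define D where "D = 4 powr u * L powr (1 - u) * real n powr (u - 1) * real ?m powr (- \<beta>)"
    have D: "0 \<le> D" by (simp add: D_def)
    have term_le: "?f i \<le> D * (real i powr \<beta> * \<bar>\<theta> i\<bar> powr p)" if i: "?m < i" for i
    proof -
      let ?x = "real i / real ?m"
      have x: "1 \<le> ?x" using m1 i by simp
      have "ln ?x \<le> ?x powr \<delta> / \<delta>" by (rule ln_powr_bound) (use x pos in auto)
      then have "2 * log 2 ?x \<le> 2 / (\<delta> * ln 2) * ?x powr \<delta>"
        using pos by (simp add: log_def field_simps)
      moreover have "1 \<le> ?x powr \<delta>" using x pos by (simp add: ge_one_powr_ge_zero)
      ultimately have "threshold p s n i \<le> L * ?x powr \<delta>"
        using threshold_bounds(2)[OF m1 i] unfolding L_def distrib_right by linarith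
      then have "threshold p s n i / real n \<le> L * ?x powr \<delta> / real n"
        using n by (intro divide_right_mono) auto
      then have "?f i \<le> min (4 * (\<theta> i)\<^sup>2) (L * ?x powr \<delta> / real n)"
        by (rule min.mono[OF order_refl])
      also have "\<dots> \<le> (4 * (\<theta> i)\<^sup>2) powr u * (L * ?x powr \<delta> / real n) powr (1 - u)"
        using pos L by (intro min_le_powr_interpolate) auto
      also have "(4 * (\<theta> i)\<^sup>2) powr u = 4 powr u * \<bar>\<theta> i\<bar> powr p"
      proof -
        have "(\<theta> i)\<^sup>2 powr u = (\<bar>\<theta> i\<bar> powr 2) powr u" by simp
        also have "\<dots> = \<bar>\<theta> i\<bar> powr p" by (simp only: powr_powr) (simp add: u_def)
        finally show ?thesis by (simp add: powr_mult)
      qed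
      also have "(L * ?x powr \<delta> / real n) powr (1 - u) = L powr (1 - u) * ?x powr \<beta> / real n powr (1 - u)"
        using pos L n x by (simp add: powr_mult powr_divide powr_powr \<delta>_def)
      also have "\<dots> = L powr (1 - u) * (real i powr \<beta> * real ?m powr (- \<beta>)) * real n powr (u - 1)"
      proof -
        have x\<beta>: "?x powr \<beta> = real i powr \<beta> * real ?m powr (- \<beta>)"
          by (simp add: powr_divide powr_minus_divide)
        have n\<beta>: "1 / real n powr (1 - u) = real n powr (u - 1)"
          using powr_minus_divide[of "real n" "1 - u"] by simp
        have "L powr (1 - u) * ?x powr \<beta> / real n powr (1 - u)
          = L powr (1 - u) * ?x powr \<beta> * (1 / real n powr (1 - u))" by simp
        then show ?thesis unfolding n\<beta> x\<beta> .
      qed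
      finally show ?thesis by (simp add: D_def mult_ac)
    qed
    have "(\<Sum>i = 1..N. ?f i) \<le> (\<Sum>i = 1..?m. ?f i) + (\<Sum>i = ?m + 1..N. ?f i)"
      using m1 by (intro sum_split_le) (simp add: threshold_nonneg)
    \<comment> \<open>Up to \<open>?m\<close> the threshold is 0, so each minimum vanishes.\<close>
    also have "(\<Sum>i = 1..?m. ?f i) = 0" by (simp add: threshold_def)
    also have "0 + (\<Sum>i = ?m + 1..N. ?f i) \<le> (\<Sum>i = ?m + 1..N. D * (real i powr \<beta> * \<bar>\<theta> i\<bar> powr p))"
      unfolding add_0 by (intro sum_mono term_le) auto
    also have "\<dots> = D * (\<Sum>i = ?m + 1..N. real i powr \<beta> * \<bar>\<theta> i\<bar> powr p)"
      by (rule sum_distrib_left[symmetric])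
    also have "\<dots> \<le> D * (K * real (?m + 1) powr (- \<beta>))"
      by (intro mult_left_mono K \<theta> D) auto
    also have "\<dots> \<le> D * (K * real ?m powr (- \<beta>))"
      using K(1) pos m1 D by (intro mult_left_mono powr_mono2') auto
    also have "\<dots> = ?C * real n powr (u - 1) * (real ?m powr (- \<beta>) * real ?m powr (- \<beta>))"
      by (simp add: D_def mult_ac)
    also have "real ?m powr (- \<beta>) * real ?m powr (- \<beta>) = real ?m powr (- p * s)"
      by (simp add: powr_add[symmetric] \<beta>_def)
    finally show ?thesis by (simp add: u_def)
  qed
  moreover have "0 < ?C" using K(1) L by simp
  ultimately show ?thesis by (rule that[rotated])
qed

text \<open>By maximality, one further doubling would exceed \<open>T\<close>.\<close>

lemma Greatest_nat_doubling:
  fixes a T :: real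
  assumes "0 < a" "a \<le> T"
  shows "T / 2 < 2 ^ (GREATEST J. 2 ^ J * a \<le> T) * a"
proof -
  let ?G = "GREATEST J. 2 ^ J * a \<le> T"
  \<comment> \<open>A bound on the admissible exponents is needed for \<open>GREATEST\<close> to
    dominate them.\<close>
  obtain b :: nat where b: "T / a < 2 ^ b" using real_arch_pow[of 2 "T / a"] by auto
  have "J \<le> b" if "2 ^ J * a \<le> T" for J
  proof (rule ccontr)
    assume "\<not> J \<le> b"
    then have "(2::real) ^ b \<le> 2 ^ J" by (intro power_increasing) auto
    also have "\<dots> \<le> T / a" using that assms by (simp add: field_simps)
    finally show False using b by simp
  qed
  then have "J \<le> ?G" if "2 ^ J * a \<le> T" for J
    using Greatest_le_nat[of "\<lambda>J. 2 ^ J * a \<le> T"] that by blast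
  from this[of "Suc ?G"] have "T < 2 ^ Suc ?G * a" by (meson not_le Suc_n_not_le_n)
  then show ?thesis by simp
qed

text \<open>Rounding down costs at most a factor 2, because the floor is at least 1.\<close>

lemma m3_bounds:
  assumes "0 \<le> p / (1 + 2 * p * s)" "1 \<le> n"
  shows "1 \<le> m3 p s n" "real (m3 p s n) \<le> real n powr (p / (1 + 2 * p * s))"
    "real n powr (p / (1 + 2 * p * s)) / 2 \<le> real (m3 p s n)"
proof -
  let ?x = "real n powr (p / (1 + 2 * p * s))"
  have x: "1 \<le> ?x" using assms by (intro ge_one_powr_ge_zero) auto
  then have fl: "1 \<le> \<lfloor>?x\<rfloor>" by simp
  then show "1 \<le> m3 p s n" by (simp add: m3_def le_nat_iff)
  have m: "real (m3 p s n) = of_int \<lfloor>?x\<rfloor>" using fl by (simp add: m3_def)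
  show "real (m3 p s n) \<le> ?x" unfolding m by simp
  have "?x < of_int \<lfloor>?x\<rfloor> + 1" "(1::real) \<le> of_int \<lfloor>?x\<rfloor>" using fl by linarith+
  then show "?x / 2 \<le> real (m3 p s n)" unfolding m by linarith
qed

theorem theorem3:
  fixes p q \<alpha> M :: real
  assumes "0 < p" "p < 2" "0 < q" "0 < M" "0 < \<alpha>" "\<alpha> \<le> 1 / (2 * p)"
    and "smooth_index \<alpha> p > 0"
  shows "\<exists>C > 0. \<exists>\<epsilon> :: nat \<Rightarrow> real. \<epsilon> \<longlonglongrightarrow> 0 \<and>
    (\<forall>\<^sub>F n in sequentially. \<forall>(P :: 'a measure) z. gauss_noise P z \<longrightarrow>
       (\<forall>\<theta> \<in> Besov_ball p q \<alpha> M \<union> Lp_ball p \<alpha> M.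
          risk3 P z p (smooth_index \<alpha> p) n \<theta>
            \<le> ennreal (C * real n powr (-(2 - p / (1 + 2 * p * smooth_index \<alpha> p))) * (1 + \<epsilon> n))))"
proof -
  define s where "s = smooth_index \<alpha> p"
  define r where "r = p / (1 + 2 * p * s)"
  have s: "0 < s" using assms by (simp add: s_def)
  \<comment> \<open>Here \<open>\<alpha> \<le> 1 / (2 * p)\<close> enters. The inequality says
    exactly that \<open>r\<close> is at least 1, so terms of order \<open>1 / n\<close> are within
    the target rate.\<close>
  have ps: "2 * p * s \<le> p - 1"
  proof -
    have "2 * p * s = 2 * p * \<alpha> + p - 2"
      using assms by (simp add: s_def smooth_index_def field_simps)
    moreover have "2 * p * \<alpha> \<le> 1" using assms by (simp add: field_simps)
    ultimately show ?thesis by linarith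
  qed
  have psp: "0 < p * s" using s assms by simp
  have r1: "1 \<le> r" using ps psp by (simp add: r_def)
  have r_eq: "r + r * (2 * p * s) = p"
  proof -
    have "r + r * (2 * p * s) = r * (1 + 2 * p * s)" by (simp only: distrib_left mult_1_right)
    also have "\<dots> = p" using psp by (simp add: r_def)
    finally show ?thesis .
  qed
  \<comment> \<open>Equivalent to \<open>2 * p * s \<le> 1\<close>, which follows from
    \<open>ps\<close> and \<open>p < 2\<close>. It places \<open>m3\<close> below the cutoff that
    defines \<open>Jstar\<close>.\<close>
  have r_le: "r \<le> 1 / (4 * s)"
  proof -
    have "2 * (2 * p * s) \<le> 1 + 2 * p * s" using ps assms(2) by linarith
    then show ?thesis using s psp by (simp add: r_def field_simps)
  qed
  obtain K1 where K1: "0 < K1" "\<And>p s n N. 1 \<le> m3 p s n \<Longrightarrow>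
      (\<Sum>i = 1..N. exp (- 2 * threshold p s n i / 5)) \<le> K1 * real (m3 p s n)"
    by (fact threshold_exp_sum)
  obtain K2 where K2: "0 < K2" "\<And>\<theta> m N. \<theta> \<in> dyadic_ball p s M \<Longrightarrow> 1 \<le> m \<Longrightarrow>
      (\<Sum>i = m..N. (\<theta> i)\<^sup>2) \<le> K2 * real m powr (- 2 * s)"
    by (fact dyadic_ball_energy[OF assms(1) less_imp_le[OF assms(2)] assms(4) s])
  obtain K3 where K3: "0 < K3" "\<And>n N \<theta>. 0 < n \<Longrightarrow> 1 \<le> m3 p s n \<Longrightarrow> \<theta> \<in> dyadic_ball p s M \<Longrightarrow>
    (\<Sum>i = 1..N. min (4 * (\<theta> i)\<^sup>2) (threshold p s n i / real n))
      \<le> K3 * real n powr (p / 2 - 1) * real (m3 p s n) powr (- p * s)"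
    by (fact threshold_bias_sum[OF assms(1,2,4) s])
  \<comment> \<open>One summand for each term of \<open>risk3_le\<close>; the powers of 2 come from
    the halves in the lower bounds on \<open>m3\<close> and \<open>N\<close>.\<close>
  define C where "C = 56 * K1 + 10 * K2 + 2 * K3\<^sup>2 * 2 powr (2 * p * s) + 2 * K2\<^sup>2 * 2 powr (4 * s)"
  have "0 < C" using K1(1) K2(1) by (simp add: C_def add_pos_nonneg)
  have risk: "risk3 P z p s n \<theta> \<le> ennreal (C * real n powr (r - 2))"
    if n: "3 \<le> n" and P: "gauss_noise P z" and \<theta>: "\<theta> \<in> dyadic_ball p s M"
    for n and P :: "'a measure" and z \<theta>
  proof -
    let ?n = "real n" and ?m = "m3 p s n"
    define N where "N = 2 ^ Jstar p s n * ?m"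
    have m: "1 \<le> ?m" "real ?m \<le> ?n powr r" "?n powr r / 2 \<le> real ?m"
      using m3_bounds[of p s n] n r1 by (auto simp: r_def)
    have N1: "1 \<le> N" using m by (simp add: N_def)
    have N: "?n powr (1 / (4 * s)) / 2 \<le> real N"
    proof -
      have "exp 1 \<le> ?n" using n e_less_272 by simp
      then have ln: "1 \<le> ln ?n" using n by (subst ln_ge_iff) auto
      define T where "T = ?n powr (1 / (4 * s)) * ln ?n"
      have T: "?n powr (1 / (4 * s)) \<le> T"
        using mult_left_mono[OF ln, of "?n powr (1 / (4 * s))"] by (simp add: T_def)
      have "real ?m \<le> ?n powr (1 / (4 * s))"
        using m(2) powr_mono[OF r_le, of ?n] n by linarith
      then have "T / 2 < real N"
        using Greatest_nat_doubling[of "real ?m" T] m T by (simp add: N_def Jstar_def T_def)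
      then show ?thesis using T by linarith
    qed
    define B where "B = K2 * real N powr (- 2 * s)"
    have tail: "(\<Sum>i = N + 1..N'. (\<theta> i)\<^sup>2) \<le> B" for N'
    proof -
      have "(\<Sum>i = N + 1..N'. (\<theta> i)\<^sup>2) \<le> (\<Sum>i = N..N'. (\<theta> i)\<^sup>2)"
        by (rule sum_mono2) auto
      also have "\<dots> \<le> B" unfolding B_def by (rule K2(2)[OF \<theta> N1])
      finally show ?thesis .
    qed
    let ?E = "\<Sum>i = 1..N. exp (- 2 * threshold p s n i / 5)"
    let ?S = "\<Sum>i = 1..N. min (4 * (\<theta> i)\<^sup>2) (threshold p s n i / ?n)"
    have inv_n: "1 / ?n \<le> ?n powr (r - 2)"
    proof -
      have "1 / ?n = ?n powr (- 1)" using n by (simp add: powr_minus_divide)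
      also have "\<dots> \<le> ?n powr (r - 2)" using r1 n by (intro powr_mono) auto
      finally show ?thesis .
    qed
    have 1: "56 * ?E / ?n\<^sup>2 \<le> 56 * K1 * ?n powr (r - 2)"
    proof -
      have "?E \<le> K1 * ?n powr r"
        using K1(2)[OF m(1), of N] mult_left_mono[OF m(2), of K1] K1(1) by linarith
      then have "56 * ?E / ?n\<^sup>2 \<le> 56 * (K1 * ?n powr r) / ?n\<^sup>2"
        by (intro divide_right_mono mult_left_mono) auto
      also have "\<dots> = 56 * K1 * ?n powr (r - 2)" using n by (simp add: powr_diff)
      finally show ?thesis .
    qed
    have 2: "10 * (\<Sum>i = 1..N. (\<theta> i)\<^sup>2) / ?n \<le> 10 * K2 * ?n powr (r - 2)"
    proof -
      \<comment> \<open>The tail bound started at index 1 bounds the total energy by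
        \<open>K2\<close>.\<close>
      have "10 * (\<Sum>i = 1..N. (\<theta> i)\<^sup>2) / ?n \<le> 10 * K2 * (1 / ?n)"
        using K2(2)[OF \<theta> order_refl, of N] n by (simp add: divide_right_mono)
      also have "\<dots> \<le> 10 * K2 * ?n powr (r - 2)"
        using K2(1) by (intro mult_left_mono inv_n) auto
      finally show ?thesis .
    qed
    have 3: "2 * ?S\<^sup>2 \<le> 2 * K3\<^sup>2 * 2 powr (2 * p * s) * ?n powr (r - 2)"
    proof -
      have S0: "0 \<le> ?S" using threshold_nonneg[OF m(1)] by (intro sum_nonneg) auto
      have "?S \<le> K3 * ?n powr (p / 2 - 1) * real ?m powr (- p * s)"
        using n by (intro K3(2) m \<theta>) auto
      also have "\<dots> \<le> K3 * ?n powr (p / 2 - 1) * (?n powr r / 2) powr (- p * s)"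
        using n m psp K3(1) by (intro mult_left_mono powr_mono2') auto
      finally have "?S\<^sup>2 \<le> (K3 * ?n powr (p / 2 - 1) * (?n powr r / 2) powr (- p * s))\<^sup>2"
        by (intro power_mono S0)
      also have "\<dots> = K3\<^sup>2 * 2 powr (2 * p * s) * ?n powr (r - 2)"
      proof -
        have sq: "(a powr b)\<^sup>2 = a powr (2 * b)" for a b :: real
          by (simp add: power2_eq_square powr_add[symmetric])
        have "(?n powr r / 2) powr (- p * s) = ?n powr (r * (- p * s)) * 2 powr (p * s)"
          by (simp add: powr_divide powr_powr powr_minus_divide)
        moreover have alg: "(k * x * (y * w))\<^sup>2 = k\<^sup>2 * w\<^sup>2 * (x\<^sup>2 * y\<^sup>2)" for k x y w :: real
          by (simp add: power_mult_distrib mult_ac)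
        ultimately have "(K3 * ?n powr (p / 2 - 1) * (?n powr r / 2) powr (- p * s))\<^sup>2
          = K3\<^sup>2 * 2 powr (2 * (p * s)) * (?n powr (2 * (p / 2 - 1)) * ?n powr (2 * (r * (- p * s))))"
          by (simp only: alg sq)
        also have "?n powr (2 * (p / 2 - 1)) * ?n powr (2 * (r * (- p * s)))
            = ?n powr (2 * (p / 2 - 1) + 2 * (r * (- p * s)))"
          by (simp only: powr_add)
        \<comment> \<open>This is \<open>r_eq\<close>: the choice of \<open>m3\<close> makes the
          squared thresholding bias match the noise variance in order.\<close>
        also have "2 * (p / 2 - 1) + 2 * (r * (- p * s)) = r - 2"
          using r_eq by (simp add: field_simps)
        finally show ?thesis by (simp only: mult.assoc)
      qed
      finally show ?thesis by simp
    qed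
    have 4: "2 * B\<^sup>2 \<le> 2 * K2\<^sup>2 * 2 powr (4 * s) * ?n powr (r - 2)"
    proof -
      \<comment> \<open>The cutoff exponent \<open>1 / (4 * s)\<close> makes the squared truncation
        bias of order \<open>1 / n\<close>.\<close>
      have "B\<^sup>2 = K2\<^sup>2 * real N powr (- 4 * s)"
        by (simp add: B_def power_mult_distrib power2_eq_square powr_add[symmetric])
      also have "\<dots> \<le> K2\<^sup>2 * (?n powr (1 / (4 * s)) / 2) powr (- 4 * s)"
        using n s N by (intro mult_left_mono powr_mono2') auto
      also have "(?n powr (1 / (4 * s)) / 2) powr (- 4 * s) = 2 powr (4 * s) * (1 / ?n)"
        using n s by (simp add: powr_divide powr_powr powr_minus_divide)
      also have "K2\<^sup>2 * (2 powr (4 * s) * (1 / ?n)) \<le> K2\<^sup>2 * (2 powr (4 * s) * ?n powr (r - 2))"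
        by (intro mult_left_mono inv_n) auto
      finally show ?thesis by simp
    qed
    have "risk3 P z p s n \<theta> \<le> ennreal (56 * ?E / ?n\<^sup>2 + 10 * (\<Sum>i = 1..N. (\<theta> i)\<^sup>2) / ?n + 2 * ?S\<^sup>2 + 2 * B\<^sup>2)"
      using n by (intro risk3_le[OF P _ m(1) N_def tail]) auto
    also have "\<dots> \<le> ennreal (C * ?n powr (r - 2))"
      unfolding C_def distrib_right by (intro ennreal_leI add_mono 1 2 3 4)
    finally show ?thesis .
  qed
  have ball: "Besov_ball p q \<alpha> M \<union> Lp_ball p \<alpha> M \<subseteq> dyadic_ball p s M"
    using Besov_ball_subset_dyadic_ball[of p q M \<alpha>] Lp_ball_subset_dyadic_ball[of p M \<alpha>] assms
    by (simp add: s_def)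
  have "\<forall>\<^sub>F n in sequentially. \<forall>(P :: 'a measure) z. gauss_noise P z \<longrightarrow>
       (\<forall>\<theta> \<in> Besov_ball p q \<alpha> M \<union> Lp_ball p \<alpha> M.
          risk3 P z p s n \<theta> \<le> ennreal (C * real n powr (- (2 - r)) * (1 + 0)))"
    using eventually_ge_at_top[of 3]
  proof eventually_elim
    case (elim n)
    then show ?case using risk ball by auto
  qed
  then show ?thesis
    \<comment> \<open>The bound holds for all \<open>n\<close> from 3 on with a fixed constant, so
      the zero sequence serves as the vanishing correction.\<close>
    using \<open>0 < C\<close> unfolding s_def r_def by (intro exI[of _ C] exI[of _ "\<lambda>_. 0"] conjI) auto
qed

end
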